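(* Let $n\ge 1$ and let $r_{\max}(n):=\left\lfloor (\sqrt{1+8n}-1)/2\right\rfloor$. Let $C_n$ be an extreme point of the elliptope $\mathcal{E}_n$ with $\mathrm{rank}(C_n)=r_{\max}(n)$. Then the $2n\times 2n$ matrix $$P_{C_n}:=\frac14\begin{pmatrix}J+C_n & J-C_n\\ J-C_n & J+C_n\end{pmatrix}$$ is a Gram-Lorentz matrix (in particular it is completely positive semidefinite), and $$\mathrm{cpsd}\text{-}\mathrm{rank}(P_{C_n})\ge \sqrt{2}^{\,\lfloor r_{\max}(n)/2\rfloor}.$$
   Context: $J$ denotes the $n\times n$ all-ones matrix. The elliptope is $\mathcal{E}_n:=\{X\in\mathcal{S}^n_+ : X_{ii}=1 \ \forall i\in[n]\}$, where $\mathcal{S}^n_+$ is the set of real symmetric positive semidefinite $n\times n$ matrices. The $m$-dimensional Lorentz cone is $\mathcal{L}_m:=\{(c,x)\in\mathbb{R}\times\mathbb{R}^{m-1}: c\ge\|x\|\}$. A real symmetric $N\times N$ matrix is Gram-Lorentz if it equals the Gram matrix $(\langle \ell_i,\ell_j\rangle)_{i,j}$ of some vectors $\ell_1,\dots,\ell_N\in\mathcal{L}_m$ for some $m\ge1$. A matrix $X$ of size $N$ is completely positive semidefinite (cpsd) if there exist $d\ge1$ and Hermitian positive semidefinite $d\times d$ matrices $P_1,\dots,P_N$ with $X_{ij}=\mathrm{Tr}(P_iP_j)$ for all $i,j$; the cpsd-rank of $X$ is the least such $d$. *)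

theory Defs
  imports Complex_Main "Jordan_Normal_Form.DL_Rank"
begin

definition ones_mat :: "nat \<Rightarrow> real mat" where
  "ones_mat n = mat n n (\<lambda>_. 1)"

definition real_psd :: "nat \<Rightarrow> real mat \<Rightarrow> bool" where
  "real_psd n X \<longleftrightarrow> X \<in> carrier_mat n n \<and> X\<^sup>T = X \<and>
     (\<forall>x \<in> carrier_vec n. 0 \<le> x \<bullet> (X *\<^sub>v x))"

definition elliptope :: "nat \<Rightarrow> real mat set" where
  "elliptope n = {X. real_psd n X \<and> (\<forall>i<n. X $$ (i,i) = 1)}"

definition extreme_mat :: "real mat set \<Rightarrow> real mat \<Rightarrow> bool" where
  "extreme_mat S C \<longleftrightarrow> C \<in> S \<and>
     (\<forall>A\<in>S. \<forall>B\<in>S. \<forall>t::real. 0 < t \<and> t < 1 \<and> C = t \<cdot>\<^sub>m A + (1 - t) \<cdot>\<^sub>m B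
        \<longrightarrow> A = C \<and> B = C)"

definition r_max :: "nat \<Rightarrow> nat" where
  "r_max n = nat \<lfloor>(sqrt (1 + 8 * real n) - 1) / 2\<rfloor>"

definition lorentz_cone :: "nat \<Rightarrow> real vec set" where
  "lorentz_cone m = {v. v \<in> carrier_vec m \<and> m \<ge> 1 \<and>
      sqrt (\<Sum>k\<in>{1..<m}. (v $ k)\<^sup>2) \<le> v $ 0}"

definition gram_lorentz :: "nat \<Rightarrow> real mat \<Rightarrow> bool" where
  "gram_lorentz N X \<longleftrightarrow> X \<in> carrier_mat N N \<and>
     (\<exists>m\<ge>1. \<exists>l :: nat \<Rightarrow> real vec. (\<forall>i<N. l i \<in> lorentz_cone m) \<and>
        (\<forall>i<N. \<forall>j<N. X $$ (i,j) = l i \<bullet> l j))"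

definition herm_psd :: "nat \<Rightarrow> complex mat \<Rightarrow> bool" where
  "herm_psd d P \<longleftrightarrow> P \<in> carrier_mat d d \<and>
     (\<forall>i<d. \<forall>j<d. P $$ (i,j) = cnj (P $$ (j,i))) \<and>
     (\<forall>v \<in> carrier_vec d.
        0 \<le> Re (\<Sum>i<d. \<Sum>j<d. cnj (v $ i) * P $$ (i,j) * v $ j))"

definition mat_trace :: "complex mat \<Rightarrow> complex" where
  "mat_trace A = (\<Sum>k<dim_row A. A $$ (k,k))"

definition cpsd_factorization :: "nat \<Rightarrow> real mat \<Rightarrow> nat \<Rightarrow> bool" where
  "cpsd_factorization N X d \<longleftrightarrow> X \<in> carrier_mat N N \<and> d \<ge> 1 \<and>
     (\<exists>P :: nat \<Rightarrow> complex mat. (\<forall>i<N. herm_psd d (P i)) \<and>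
        (\<forall>i<N. \<forall>j<N. complex_of_real (X $$ (i,j)) = mat_trace (P i * P j)))"

definition cpsd :: "nat \<Rightarrow> real mat \<Rightarrow> bool" where
  "cpsd N X \<longleftrightarrow> (\<exists>d. cpsd_factorization N X d)"

definition cpsd_rank :: "nat \<Rightarrow> real mat \<Rightarrow> nat" where
  "cpsd_rank N X = (LEAST d. cpsd_factorization N X d)"

definition P_mat :: "nat \<Rightarrow> real mat \<Rightarrow> real mat" where
  "P_mat n C = (1/4 :: real) \<cdot>\<^sub>m
     four_block_mat (ones_mat n + C) (ones_mat n - C) (ones_mat n - C) (ones_mat n + C)"

end

(* Write C as the Gram matrix of unit vectors u_i in R^r.

   Upper bound: the entries of P_C are the inner products of the Lorentz vectors (1, u_i) / 2 and
   (1, -u_i) / 2, and u |-> (I + sum_k u_k gamma_k) / (2 sqrt D), for Clifford generators gamma_k of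
   size D, maps these to positive semidefinite matrices with the same inner products.

   Lower bound: let A_i, B_i be the two halves of a factorization of size d. The prescribed traces
   give A_i B_i = 0 and A_i + B_i = K for all i, so M_i = A_i - B_i satisfies M_i^2 = K^2. Since C is
   the Gram matrix of the M_i, these are M_i = sum_k u_ik X_k for Hermitian X_k, and extremality of
   C, i.e. the fact that the u_i u_i^T span the symmetric matrices, turns M_i^2 = K^2 into
   X_k X_l + X_l X_k = 2 delta_kl K^2. The products of the pairs X_2j X_2j+1 over all sets of j are
   2^(r div 2) matrices of size d with Tr (W_s W_t) = 0 iff s differs from t. They are linearly
   independent, so 2^(r div 2) is at most d^2, where r is at least the rank of C. *)

theory Submission
  imports Defs
begin

section \<open>Gram decompositions and extreme points of the elliptope\<close>

text \<open>The Gram vectors of \<open>C\<close> come with dual coefficient vectors \<open>f\<close>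
  satisfying \<open>u k\<close> = C \<open>f k\<close> and <\<open>f k\<close>, \<open>u l\<close>>
  = delta_kl. These duals replace all basis arguments: they recover Z from U^T Z U, they give X_k =
  sum_i f_ki M_i, and they put the coefficient vector of M_i - sum_k u_ik X_k into the kernel of
  \<open>C\<close>, so that this matrix has Frobenius norm zero. The obstacle in the lower bound is
  that K^2 is in general neither a multiple of the identity nor invertible, so the X_k cannot simply
  be rescaled to Clifford generators. A pair squares to -K^4 and not to a scalar; orthogonality is
  therefore carried through the induction with all weights, as a statement on Tr (W_s W_t K^(2p))
  for every p. The diagonal values survive because a nonzero Hermitian matrix is not nilpotent.
  Products over arbitrary sets of generators would not do: the three Pauli matrices anticommute, yet
  their product is a multiple of the identity.\<close>

definition psd_form :: "'a set \<Rightarrow> ('a \<Rightarrow> 'a \<Rightarrow> real) \<Rightarrow> bool" where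
  "psd_form I A \<longleftrightarrow> finite I \<and> (\<forall>i\<in>I. \<forall>j\<in>I. A i j = A j i) \<and>
     (\<forall>x. 0 \<le> (\<Sum>i\<in>I. \<Sum>j\<in>I. x i * A i j * x j))"

lemma linear_dominated_by_square:
  fixes b c :: real
  assumes "\<And>t. 0 \<le> t * b + t\<^sup>2 * c"
  shows "b = 0"
proof (rule ccontr)
  assume b: "b \<noteq> 0"
  \<comment> \<open>The value t = -b/s only has to make the parabola negative; choosing s positive
    and above c covers both signs of c at once.\<close>
  define s where "s = 1 + \<bar>c\<bar>"
  have s: "s > 0" "c < s" by (auto simp: s_def)
  have "(- b / s) * b + (- b / s)\<^sup>2 * c = b\<^sup>2 * (c - s) / s\<^sup>2"
    using s by (simp add: field_simps power2_eq_square)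
  also have "\<dots> < 0"
    using b s by (simp add: divide_neg_pos mult_pos_neg)
  finally show False
    using assms[of "- b / s"] by simp
qed

text \<open>The form is minimal at \<open>g\<close>. Moving \<open>g\<close> to g + t e_k leaves no
  constant term, so the linear coefficient 2 (A g)_k has to vanish.\<close>

lemma psd_form_null:
  assumes "psd_form I A" "k \<in> I"
    and "(\<Sum>i\<in>I. \<Sum>j\<in>I. g i * A i j * g j) = 0"
  shows "(\<Sum>j\<in>I. A k j * g j) = 0"
proof -
  have fin: "finite I" and sym: "\<And>i j. i \<in> I \<Longrightarrow> j \<in> I \<Longrightarrow> A i j = A j i"
    and pos: "\<And>x. 0 \<le> (\<Sum>i\<in>I. \<Sum>j\<in>I. x i * A i j * x j)"
    using assms(1) by (auto simp: psd_form_def)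
  define e where "e i = (if i = k then 1 else 0 :: real)" for i
  have ge: "(\<Sum>i\<in>I. \<Sum>j\<in>I. g i * A i j * e j) = (\<Sum>j\<in>I. A k j * g j)"
    using fin assms(2) by (auto simp: e_def if_distrib cong: if_cong intro!: sum.cong dest: sym)
  have eg: "(\<Sum>i\<in>I. \<Sum>j\<in>I. e i * A i j * g j) = (\<Sum>j\<in>I. A k j * g j)"
  proof -
    have "(\<Sum>i\<in>I. \<Sum>j\<in>I. e i * A i j * g j) = (\<Sum>i\<in>I. e i * (\<Sum>j\<in>I. A i j * g j))"
      by (simp add: sum_distrib_left mult.assoc)
    also have "\<dots> = (\<Sum>j\<in>I. A k j * g j)"
      using fin assms(2) by (simp add: e_def if_distrib[of "\<lambda>x. x * _"] cong: if_cong)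
    finally show ?thesis .
  qed
  have "0 \<le> t * (2 * (\<Sum>j\<in>I. A k j * g j)) + t\<^sup>2 * (\<Sum>i\<in>I. \<Sum>j\<in>I. e i * A i j * e j)" for t
  proof -
    have "0 \<le> (\<Sum>i\<in>I. \<Sum>j\<in>I. (g i + t * e i) * A i j * (g j + t * e j))"
      by (rule pos)
    also have "\<dots> = (\<Sum>i\<in>I. \<Sum>j\<in>I. g i * A i j * g j) + t * (\<Sum>i\<in>I. \<Sum>j\<in>I. g i * A i j * e j)
        + t * (\<Sum>i\<in>I. \<Sum>j\<in>I. e i * A i j * g j) + t\<^sup>2 * (\<Sum>i\<in>I. \<Sum>j\<in>I. e i * A i j * e j)"
      by (simp add: algebra_simps sum.distrib sum_distrib_left power2_eq_square)
    finally show ?thesis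
      using assms(3) ge eg by simp
  qed
  from linear_dominated_by_square[OF this] show ?thesis by simp
qed

text \<open>Pivoted Cholesky decomposition, i.e. Gram-Schmidt with respect to the form \<open>A\<close>: every column
  \<open>u k\<close> of the factor comes with a coefficient vector \<open>f k\<close> such that \<open>u k = A f k\<close>.\<close>

lemma psd_form_gram:
  assumes psd: "psd_form I A"
  obtains r f u where
    "\<And>k i. u k i = (\<Sum>j\<in>I. A i j * f k j)"
    "\<And>k l. k < (r::nat) \<Longrightarrow> l < r \<Longrightarrow> (\<Sum>i\<in>I. f k i * u l i) = (if k = l then 1 else 0)"
    "\<And>i j. i \<in> I \<Longrightarrow> j \<in> I \<Longrightarrow> A i j = (\<Sum>k<r. u k i * u k j)"
proof -
  have fin: "finite I" and sym: "\<And>i j. i \<in> I \<Longrightarrow> j \<in> I \<Longrightarrow> A i j = A j i"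
    and pos: "\<And>x. 0 \<le> (\<Sum>i\<in>I. \<Sum>j\<in>I. x i * A i j * x j)"
    using psd by (auto simp: psd_form_def)
  \<comment> \<open>Rows are restricted to the processed set \<open>J\<close>, but columns range
    over all of \<open>I\<close>: the residual of a new pivot then already vanishes on
    \<open>J\<close>, and adding its rank-one term leaves the finished rows intact.\<close>
  define Q where "Q J r f u \<longleftrightarrow> (\<forall>k i. u k i = (\<Sum>j\<in>I. A i j * f k j)) \<and>
      (\<forall>k<r::nat. \<forall>l<r. (\<Sum>i\<in>I. f k i * u l i) = (if k = l then 1 else 0)) \<and>
      (\<forall>i\<in>J. \<forall>j\<in>I. A i j = (\<Sum>k<r. u k i * u k j))" for J r f u
  have "\<exists>r f u. Q J r f u" if "finite J" "J \<subseteq> I" for J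
    using that
  proof (induction J rule: finite_induct)
    case empty
    have "Q {} 0 (\<lambda>_ _. 0) (\<lambda>_ _. 0)"
      by (simp add: Q_def)
    then show ?case by blast
  next
    case (insert m J)
    then obtain r f u where Q: "Q J r f u"
      by blast
    then have u: "\<And>k i. u k i = (\<Sum>j\<in>I. A i j * f k j)"
      and orth: "\<And>k l. k < r \<Longrightarrow> l < r \<Longrightarrow> (\<Sum>i\<in>I. f k i * u l i) = (if k = l then 1 else 0)"
      and dec: "\<And>i j. i \<in> J \<Longrightarrow> j \<in> I \<Longrightarrow> A i j = (\<Sum>k<r. u k i * u k j)"
      unfolding Q_def by blast+
    have m: "m \<in> I" using insert.prems by simp
    \<comment> \<open>\<open>D\<close> is column m of the residual (Schur complement) of A.
      \<open>g\<close> is e_m orthogonalized against the previous \<open>f k\<close>, so that A g =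
      D and g^T A g = D m.\<close>
    define D where "D i = A i m - (\<Sum>k<r. u k m * u k i)" for i
    define g where "g l = (if l = m then 1 else 0) - (\<Sum>k<r. u k m * f k l)" for l
    have Ag: "(\<Sum>j\<in>I. A i j * g j) = D i" for i
    proof -
      have "(\<Sum>j\<in>I. A i j * g j) = (\<Sum>j\<in>I. A i j * (if j = m then 1 else 0))
          - (\<Sum>j\<in>I. \<Sum>k<r. u k m * (A i j * f k j))"
        by (simp add: g_def right_diff_distrib sum_subtractf sum_distrib_left mult.left_commute)
      also have "(\<Sum>j\<in>I. A i j * (if j = m then 1 else 0)) = A i m"
        using fin m by (simp add: if_distrib cong: if_cong)
      also have "(\<Sum>j\<in>I. \<Sum>k<r. u k m * (A i j * f k j)) = (\<Sum>k<r. u k m * u k i)"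
        by (subst sum.swap) (simp add: u sum_distrib_left)
      finally show ?thesis by (simp add: D_def)
    qed
    have gsum: "(\<Sum>l\<in>I. g l * h l) = h m - (\<Sum>k<r. u k m * (\<Sum>l\<in>I. f k l * h l))" for h
    proof -
      have "(\<Sum>l\<in>I. g l * h l) = (\<Sum>l\<in>I. (if l = m then 1 else 0) * h l)
          - (\<Sum>l\<in>I. \<Sum>k<r. u k m * (f k l * h l))"
        by (simp add: g_def left_diff_distrib sum_subtractf sum_distrib_right mult.assoc)
      also have "(\<Sum>l\<in>I. (if l = m then 1 else 0) * h l) = h m"
        using fin m by (simp add: if_distrib[of "\<lambda>x. x * _"] cong: if_cong)
      also have "(\<Sum>l\<in>I. \<Sum>k<r. u k m * (f k l * h l)) = (\<Sum>k<r. u k m * (\<Sum>l\<in>I. f k l * h l))"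
        by (subst sum.swap) (simp add: sum_distrib_left)
      finally show ?thesis .
    qed
    have gu: "(\<Sum>l\<in>I. g l * u k l) = 0" if "k < r" for k
    proof -
      have "(\<Sum>k'<r. u k' m * (\<Sum>l\<in>I. f k' l * u k l)) = (\<Sum>k'<r. u k' m * (if k' = k then 1 else 0))"
        by (rule sum.cong) (use that in \<open>auto simp: orth\<close>)
      also have "\<dots> = u k m"
        using that by (simp add: if_distrib cong: if_cong)
      finally show ?thesis by (simp add: gsum)
    qed
    have fD: "(\<Sum>i\<in>I. f k i * D i) = 0" if "k < r" for k
    proof -
      have "(\<Sum>i\<in>I. f k i * D i) = (\<Sum>i\<in>I. \<Sum>j\<in>I. f k i * (A i j * g j))"
        by (simp add: Ag[symmetric] sum_distrib_left)
      also have "\<dots> = (\<Sum>j\<in>I. \<Sum>i\<in>I. f k i * (A i j * g j))"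
        by (rule sum.swap)
      also have "\<dots> = (\<Sum>j\<in>I. g j * u k j)"
        unfolding u sum_distrib_left by (intro sum.cong refl) (simp add: sym)
      finally show ?thesis using gu that by simp
    qed
    have gD: "(\<Sum>i\<in>I. g i * D i) = D m"
      by (subst gsum) (simp add: fD)
    have gAg: "(\<Sum>i\<in>I. \<Sum>j\<in>I. g i * A i j * g j) = D m"
      unfolding gD[symmetric] by (simp add: Ag[symmetric] sum_distrib_left mult.assoc)
    have DJ: "D i = 0" if "i \<in> J" for i
      using dec[OF that m] by (simp add: D_def mult.commute)
    show ?case
    \<comment> \<open>If the pivot is zero, \<open>g\<close> is a null vector of the form, so D = A
      g vanishes everywhere and row m is already decomposed. Otherwise \<open>g\<close> and
      \<open>D\<close> are normalized by the square root of the pivot.\<close>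
    proof (cases "D m = 0")
      case True
      have "D i = 0" if "i \<in> I" for i
        using psd_form_null[OF psd that, of g] gAg True Ag by simp
      then have "A m j = (\<Sum>k<r. u k m * u k j)" if "j \<in> I" for j
        using that sym[OF m that] by (simp add: D_def)
      then have "Q (insert m J) r f u"
        using Q unfolding Q_def by blast
      then show ?thesis by blast
    next
      case False
      have Dpos: "D m > 0"
        using pos[of g] gAg False by simp
      define s where "s = sqrt (D m)"
      have s: "s > 0" "s * s = D m"
        using Dpos by (auto simp: s_def)
      define f' where "f' k = (if k = r then (\<lambda>i. g i / s) else f k)" for k
      define u' where "u' k = (if k = r then (\<lambda>i. D i / s) else u k)" for k
      have u': "u' k i = (\<Sum>j\<in>I. A i j * f' k j)" for k i
        by (simp add: u'_def f'_def u Ag[symmetric] sum_divide_distrib)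
      have orth': "(\<Sum>i\<in>I. f' k i * u' l i) = (if k = l then 1 else 0)"
        if "k < Suc r" "l < Suc r" for k l
      proof -
        have "(\<Sum>i\<in>I. f k i * (D i / s)) = 0" if "k < r" for k
          using fD[OF that] by (simp add: sum_divide_distrib[symmetric])
        moreover have "(\<Sum>i\<in>I. g i / s * u l i) = 0" if "l < r" for l
          using gu[OF that] by (simp add: sum_divide_distrib[symmetric])
        moreover have "(\<Sum>i\<in>I. g i / s * (D i / s)) = 1"
          using gD s Dpos by (simp add: sum_divide_distrib[symmetric])
        ultimately show ?thesis
          using that orth by (auto simp: f'_def u'_def less_Suc_eq)
      qed
      have dec': "A i j = (\<Sum>k<Suc r. u' k i * u' k j)" if "i \<in> insert m J" "j \<in> I" for i j
      proof -
        have eq: "(\<Sum>k<Suc r. u' k i * u' k j) = (\<Sum>k<r. u k i * u k j) + D i * D j / D m"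
          using s by (simp add: u'_def)
        show ?thesis
        proof (cases "i = m")
          case True
          then show ?thesis
            using eq Dpos sym[OF m that(2)] by (simp add: D_def)
        next
          case False
          then show ?thesis
            using that eq dec[of i j] DJ[of i] by simp
        qed
      qed
      have "Q (insert m J) (Suc r) f' u'"
        using u' orth' dec' unfolding Q_def by blast
      then show ?thesis by blast
    qed
  qed
  from this[OF fin order_refl] obtain r f u where "Q I r f u"
    by blast
  then show thesis
    using that[of u f r] unfolding Q_def by blast
qed

section \<open>Matrices as forms, and rank versus Gram length\<close>

lemma real_psd_iff_psd_form:
  "real_psd n X \<longleftrightarrow> X \<in> carrier_mat n n \<and> psd_form {..<n} (\<lambda>i j. X $$ (i,j))"
proof (cases "X \<in> carrier_mat n n")
  case X: True
  have sym: "X\<^sup>T = X \<longleftrightarrow> (\<forall>i\<in>{..<n}. \<forall>j\<in>{..<n}. X $$ (i,j) = X $$ (j,i))"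
  proof
    assume "X\<^sup>T = X"
    then show "\<forall>i\<in>{..<n}. \<forall>j\<in>{..<n}. X $$ (i,j) = X $$ (j,i)"
      using X by (metis carrier_matD index_transpose_mat(1) lessThan_iff)
  next
    assume "\<forall>i\<in>{..<n}. \<forall>j\<in>{..<n}. X $$ (i,j) = X $$ (j,i)"
    then show "X\<^sup>T = X"
      using X by (intro eq_matI) auto
  qed
  have form: "v \<bullet> (X *\<^sub>v v) = (\<Sum>i<n. \<Sum>j<n. v $ i * X $$ (i,j) * v $ j)"
    if "v \<in> carrier_vec n" for v
    using X that
    by (simp add: scalar_prod_def mult_mat_vec_def sum_distrib_left mult.assoc atLeast0LessThan)
  have "(\<forall>v\<in>carrier_vec n. 0 \<le> v \<bullet> (X *\<^sub>v v)) \<longleftrightarrow>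
      (\<forall>x. 0 \<le> (\<Sum>i<n. \<Sum>j<n. x i * X $$ (i,j) * x j))"
  proof
    assume l: "\<forall>v\<in>carrier_vec n. 0 \<le> v \<bullet> (X *\<^sub>v v)"
    show "\<forall>x. 0 \<le> (\<Sum>i<n. \<Sum>j<n. x i * X $$ (i,j) * x j)"
    proof
      fix x
      show "0 \<le> (\<Sum>i<n. \<Sum>j<n. x i * X $$ (i,j) * x j)"
        using l[rule_format, of "vec n x"] form[of "vec n x"] by simp
    qed
  qed (simp add: form)
  then show ?thesis
    using X sym by (simp add: real_psd_def psd_form_def)
qed (simp add: real_psd_def)

text \<open>A sum of r outer products has rank at most r by subadditivity. The inequality points the
  right way: a longer Gram family only strengthens the dimension bound.\<close>

lemma rank_le_of_gram:
  fixes C :: "'a::field mat"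
  assumes "C \<in> carrier_mat n m"
    and "\<And>i j. i < n \<Longrightarrow> j < m \<Longrightarrow> C $$ (i,j) = (\<Sum>k<r. u k i * v k j)"
  shows "vec_space.rank n C \<le> r"
proof -
  have "vec_space.rank n (mat n m (\<lambda>(i,j). \<Sum>k<r. u k i * v k j)) \<le> r"
  proof (induction r)
    case 0
    have "mat n m (\<lambda>(i,j). \<Sum>k<0. u k i * v k j) = 0\<^sub>m n m"
      by (intro eq_matI) auto
    then show ?case
      by (metis le_zero_eq vec_space.rank_0I)
  next
    case (Suc r)
    let ?A = "mat n m (\<lambda>(i,j). \<Sum>k<r. u k i * v k j)"
    let ?B = "mat n m (\<lambda>(i,j). u r i * v r j)"
    have "mat n m (\<lambda>(i,j). \<Sum>k<Suc r. u k i * v k j) = ?A + ?B"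
      by (intro eq_matI) auto
    moreover have "vec_space.rank n (?A + ?B) \<le> vec_space.rank n ?A + vec_space.rank n ?B"
      by (rule vec_space.rank_subadditive) auto
    moreover have "vec_space.rank n ?B \<le> 1"
      by (rule vec_space.rank_le_1_product_entries[where f = "u r" and g = "v r"]) auto
    ultimately show ?case
      using Suc.IH by simp
  qed
  moreover have "C = mat n m (\<lambda>(i,j). \<Sum>k<r. u k i * v k j)"
    using assms by (intro eq_matI) auto
  ultimately show ?thesis by simp
qed

section \<open>Perturbations of an extreme point\<close>

lemma sum_rotate:
  "(\<Sum>i\<in>A. \<Sum>j\<in>B. \<Sum>k\<in>K. g i j k) = (\<Sum>k\<in>K. \<Sum>i\<in>A. \<Sum>j\<in>B. g i j k)"
proof -
  have "(\<Sum>i\<in>A. \<Sum>j\<in>B. \<Sum>k\<in>K. g i j k) = (\<Sum>i\<in>A. \<Sum>k\<in>K. \<Sum>j\<in>B. g i j k)"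
    by (intro sum.cong refl sum.swap)
  also have "\<dots> = (\<Sum>k\<in>K. \<Sum>i\<in>A. \<Sum>j\<in>B. g i j k)"
    by (rule sum.swap)
  finally show ?thesis .
qed

text \<open>A crude operator norm bound for Z, which tells how small t must be for I + t Z to stay
  positive semidefinite.\<close>

lemma quadratic_form_bound:
  fixes Z :: "nat \<Rightarrow> nat \<Rightarrow> real"
  shows "\<bar>\<Sum>k<r. \<Sum>l<r. y k * Z k l * y l\<bar> \<le> (\<Sum>k<r. \<Sum>l<r. \<bar>Z k l\<bar>) * (\<Sum>k<r. (y k)\<^sup>2)"
proof -
  have "\<bar>\<Sum>k<r. \<Sum>l<r. y k * Z k l * y l\<bar> \<le> (\<Sum>k<r. \<Sum>l<r. \<bar>y k * Z k l * y l\<bar>)"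
    by (intro order_trans[OF sum_abs] sum_mono sum_abs)
  also have "\<dots> \<le> (\<Sum>k<r. \<Sum>l<r. \<bar>Z k l\<bar> * (\<Sum>k<r. (y k)\<^sup>2))"
  proof (intro sum_mono)
    fix k l assume kl: "k \<in> {..<r}" "l \<in> {..<r}"
    have sq: "(y i)\<^sup>2 \<le> (\<Sum>k<r. (y k)\<^sup>2)" if "i \<in> {..<r}" for i
      using that by (intro member_le_sum) auto
    have "2 * (\<bar>y k\<bar> * \<bar>y l\<bar>) \<le> (y k)\<^sup>2 + (y l)\<^sup>2"
      using sum_squares_bound[of "\<bar>y k\<bar>" "\<bar>y l\<bar>"] by (simp add: mult.assoc)
    then have "\<bar>y k\<bar> * \<bar>y l\<bar> \<le> (\<Sum>k<r. (y k)\<^sup>2)"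
      using sq[OF kl(1)] sq[OF kl(2)] by linarith
    then have "\<bar>Z k l\<bar> * (\<bar>y k\<bar> * \<bar>y l\<bar>) \<le> \<bar>Z k l\<bar> * (\<Sum>k<r. (y k)\<^sup>2)"
      by (rule mult_left_mono) simp
    then show "\<bar>y k * Z k l * y l\<bar> \<le> \<bar>Z k l\<bar> * (\<Sum>k<r. (y k)\<^sup>2)"
      by (simp add: abs_mult mult_ac)
  qed
  finally show ?thesis
    by (simp add: sum_distrib_right)
qed

text \<open>If \<open>Z\<close> were nonzero, then \<open>C \<plusminus> e U\<^sup>T Z U\<close> would be a nontrivial segment around \<open>C\<close>
  in the elliptope.\<close>

lemma extreme_elliptope_perturbation:
  assumes ext: "extreme_mat (elliptope n) C"
    and orth: "\<And>k l. k < (r::nat) \<Longrightarrow> l < r \<Longrightarrow> (\<Sum>i<n. f k i * u l i) = (if k = l then 1 else 0)"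
    and dec: "\<And>i j. i < n \<Longrightarrow> j < n \<Longrightarrow> C $$ (i,j) = (\<Sum>k<r. u k i * u k j)"
    and Zsym: "\<And>k l. k < r \<Longrightarrow> l < r \<Longrightarrow> Z k l = Z l k"
    and Z0: "\<And>i. i < n \<Longrightarrow> (\<Sum>k<r. \<Sum>l<r. u k i * Z k l * u l i) = 0"
    and kl: "k < r" "l < r"
  shows "Z k l = (0::real)"
proof -
  have C: "C \<in> elliptope n" "C \<in> carrier_mat n n"
    using ext by (auto simp: extreme_mat_def elliptope_def real_psd_def)
  define H where "H i j = (\<Sum>k<r. \<Sum>l<r. u k i * Z k l * u l j)" for i j
  define S where "S = (\<Sum>k<r. \<Sum>l<r. \<bar>Z k l\<bar>)"
  \<comment> \<open>\<open>E t\<close> below is U^T (I + t Z) U, and \<bar>t\<bar> * S \<le> 1 keeps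
    the inner matrix positive semidefinite. The summand 1 keeps the denominator positive when Z =
    0.\<close>
  define e where "e = 1 / (1 + S)"
  have S: "S \<ge> 0" by (auto simp: S_def intro!: sum_nonneg)
  then have e: "e > 0" "e * S \<le> 1" by (auto simp: e_def)
  define E where "E t = mat n n (\<lambda>(i,j). C $$ (i,j) + t * H i j)" for t
  have Hsym: "H i j = H j i" for i j
  proof -
    have "H i j = (\<Sum>l<r. \<Sum>k<r. u k i * Z k l * u l j)"
      unfolding H_def by (rule sum.swap)
    also have "\<dots> = H j i"
      unfolding H_def by (intro sum.cong refl) (simp add: Zsym mult_ac)
    finally show ?thesis .
  qed
  have El: "E t \<in> elliptope n" if t: "\<bar>t\<bar> = e" for t
  proof -
    have "0 \<le> (\<Sum>i<n. \<Sum>j<n. x i * E t $$ (i,j) * x j)" for x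
    proof -
      define y where "y k = (\<Sum>i<n. x i * u k i)" for k
      have yy: "(\<Sum>i<n. \<Sum>j<n. x i * (u k i * u l j) * x j) = y k * y l" for k l
        by (simp add: y_def sum_product mult_ac)
      have "x i * E t $$ (i,j) * x j = (\<Sum>k<r. x i * (u k i * u k j) * x j)
          + (\<Sum>k<r. \<Sum>l<r. t * Z k l * (x i * (u k i * u l j) * x j))"
        if ij: "i < n" "j < n" for i j
      proof -
        have "x i * E t $$ (i,j) * x j = x i * (\<Sum>k<r. u k i * u k j) * x j
            + t * (x i * (\<Sum>k<r. \<Sum>l<r. u k i * Z k l * u l j) * x j)"
          using ij by (simp add: E_def H_def dec distrib_left distrib_right)
        then show ?thesis
          by (simp add: sum_distrib_left sum_distrib_right mult_ac)
      qed
      then have "(\<Sum>i<n. \<Sum>j<n. x i * E t $$ (i,j) * x j) =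
          (\<Sum>i<n. \<Sum>j<n. \<Sum>k<r. x i * (u k i * u k j) * x j)
          + (\<Sum>i<n. \<Sum>j<n. \<Sum>k<r. \<Sum>l<r. t * Z k l * (x i * (u k i * u l j) * x j))"
        unfolding sum.distrib[symmetric] by (intro sum.cong refl) simp
      also have "(\<Sum>i<n. \<Sum>j<n. \<Sum>k<r. x i * (u k i * u k j) * x j) = (\<Sum>k<r. (y k)\<^sup>2)"
      proof -
        have "(\<Sum>i<n. \<Sum>j<n. \<Sum>k<r. x i * (u k i * u k j) * x j)
            = (\<Sum>k<r. \<Sum>i<n. \<Sum>j<n. x i * (u k i * u k j) * x j)"
          by (rule sum_rotate)
        then show ?thesis by (simp add: yy power2_eq_square)
      qed
      also have "(\<Sum>i<n. \<Sum>j<n. \<Sum>k<r. \<Sum>l<r. t * Z k l * (x i * (u k i * u l j) * x j))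
          = t * (\<Sum>k<r. \<Sum>l<r. y k * Z k l * y l)"
      proof -
        have "(\<Sum>i<n. \<Sum>j<n. \<Sum>k<r. \<Sum>l<r. t * Z k l * (x i * (u k i * u l j) * x j))
            = (\<Sum>k<r. \<Sum>l<r. \<Sum>i<n. \<Sum>j<n. t * Z k l * (x i * (u k i * u l j) * x j))"
          by (subst sum_rotate) (intro sum.cong refl sum_rotate)
        also have "\<dots> = (\<Sum>k<r. \<Sum>l<r. t * Z k l * (y k * y l))"
          by (simp add: sum_distrib_left[symmetric] yy)
        finally show ?thesis by (simp add: sum_distrib_left mult_ac)
      qed
      finally have eq: "(\<Sum>i<n. \<Sum>j<n. x i * E t $$ (i,j) * x j) =
          (\<Sum>k<r. (y k)\<^sup>2) + t * (\<Sum>k<r. \<Sum>l<r. y k * Z k l * y l)" .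
      have "\<bar>t * (\<Sum>k<r. \<Sum>l<r. y k * Z k l * y l)\<bar> \<le> e * (S * (\<Sum>k<r. (y k)\<^sup>2))"
        unfolding abs_mult t S_def using e by (intro mult_left_mono quadratic_form_bound) simp
      also have "\<dots> \<le> 1 * (\<Sum>k<r. (y k)\<^sup>2)"
        unfolding mult.assoc[symmetric] using e by (intro mult_right_mono sum_nonneg) auto
      finally show ?thesis
        unfolding eq by linarith
    qed
    then have "real_psd n (E t)"
      unfolding real_psd_iff_psd_form psd_form_def
      using C Hsym by (auto simp: E_def dec mult.commute)
    moreover have "E t $$ (i,i) = 1" if "i < n" for i
      using C that Z0 by (simp add: E_def H_def elliptope_def)
    ultimately show ?thesis
      by (simp add: elliptope_def)
  qed
  have "C = (1/2) \<cdot>\<^sub>m E e + (1 - 1/2) \<cdot>\<^sub>m E (- e)"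
    using C by (intro eq_matI) (auto simp: E_def field_simps)
  then have "E e = C"
    using ext[unfolded extreme_mat_def, THEN conjunct2, rule_format, OF El[of e] El[of "- e"], of "1/2"] e
    by simp
  then have H0: "H i j = 0" if "i < n" "j < n" for i j
  proof -
    have "E e $$ (i,j) = C $$ (i,j)" using \<open>E e = C\<close> by simp
    then show ?thesis using that e by (simp add: E_def)
  qed
  \<comment> \<open>The dual vectors invert Z |-> U^T Z U: f_k^T H f_l = Z_kl.\<close>
  have "0 = (\<Sum>i<n. \<Sum>j<n. f k i * H i j * f l j)"
    by (simp add: H0)
  also have "\<dots> = (\<Sum>i<n. \<Sum>j<n. \<Sum>a<r. \<Sum>b<r. Z a b * (f k i * u a i) * (f l j * u b j))"
    by (simp add: H_def sum_distrib_left sum_distrib_right mult_ac)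
  also have "\<dots> = (\<Sum>a<r. \<Sum>b<r. \<Sum>i<n. \<Sum>j<n. Z a b * (f k i * u a i) * (f l j * u b j))"
    by (subst sum_rotate) (intro sum.cong refl sum_rotate)
  also have "\<dots> = (\<Sum>a<r. \<Sum>b<r. Z a b * (\<Sum>i<n. f k i * u a i) * (\<Sum>j<n. f l j * u b j))"
    by (simp add: sum_distrib_left sum_distrib_right mult_ac)
  also have "\<dots> = (\<Sum>a<r. \<Sum>b<r. if l = b then (if k = a then Z a b else 0) else 0)"
    by (intro sum.cong refl) (use kl in \<open>simp add: orth\<close>)
  also have "\<dots> = Z k l"
    using kl by simp
  finally show ?thesis by simp
qed

section \<open>Trace-orthogonal products of Clifford generators\<close>

lemma mat_trace_mult:
  assumes "A \<in> carrier_mat d d" "B \<in> carrier_mat d d"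
  shows "mat_trace (A * B) = (\<Sum>i<d. \<Sum>j<d. A $$ (i,j) * B $$ (j,i))"
  using assms by (simp add: mat_trace_def scalar_prod_def atLeast0LessThan)

lemma mat_trace_mult_commute:
  assumes "A \<in> carrier_mat d d" "B \<in> carrier_mat d d"
  shows "mat_trace (A * B) = mat_trace (B * A)"
  unfolding mat_trace_mult[OF assms] mat_trace_mult[OF assms(2,1)]
  by (subst sum.swap) (simp add: mult.commute)

lemma mat_trace_uminus:
  assumes "A \<in> carrier_mat d d"
  shows "mat_trace (- A) = - mat_trace A"
  using assms by (simp add: mat_trace_def sum_negf)

text \<open>The Gram matrix of the \<open>W s\<close> under (A, B) |-> Tr (A B) is diagonal with
  nonzero entries, yet it factors through the d^2 matrix positions, enumerated by \<open>h\<close>.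
  Padding both factors with zeros to size N makes determinants applicable: for d^2 < N the factor
  \<open>V\<close> has a zero column.\<close>

lemma trace_orthogonal_card_le:
  assumes W: "\<And>s. s < N \<Longrightarrow> W s \<in> carrier_mat d d"
    and orth: "\<And>s t. s < N \<Longrightarrow> t < N \<Longrightarrow> mat_trace (W s * W t) = 0 \<longleftrightarrow> s \<noteq> t"
  shows "N \<le> d * d"
proof (rule ccontr)
  assume "\<not> N \<le> d * d"
  then have N: "d * d < N" by simp
  obtain h where h: "bij_betw h {0..<d * d} ({..<d} \<times> {..<d})"
    using ex_bij_betw_nat_finite[of "{..<d} \<times> {..<d}"] by auto
  define V where "V = mat N N (\<lambda>(s,i). if i < d * d then W s $$ h i else 0)"
  define U where "U = mat N N (\<lambda>(i,t). if i < d * d then W t $$ prod.swap (h i) else 0)"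
  have car: "V \<in> carrier_mat N N" "U \<in> carrier_mat N N"
    by (auto simp: V_def U_def)
  have VU: "(V * U) $$ (s,t) = mat_trace (W s * W t)" if "s < N" "t < N" for s t
  proof -
    have "(V * U) $$ (s,t) = (\<Sum>i\<in>{0..<N}. if i < d * d then W s $$ h i * W t $$ prod.swap (h i) else 0)"
      using that by (simp add: V_def U_def scalar_prod_def if_distrib cong: if_cong)
    also have "\<dots> = (\<Sum>i\<in>{0..<d * d}. W s $$ h i * W t $$ prod.swap (h i))"
      using N by (intro sum.mono_neutral_cong_right) auto
    also have "\<dots> = (\<Sum>p\<in>{..<d} \<times> {..<d}. W s $$ p * W t $$ prod.swap p)"
      by (rule sum.reindex_bij_betw[OF h])
    also have "\<dots> = mat_trace (W s * W t)"
      by (simp add: mat_trace_mult[OF W W] that sum.cartesian_product case_prod_unfold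
          prod.swap_def)
    finally show ?thesis .
  qed
  have "V *\<^sub>v unit_vec N (d * d) = 0\<^sub>v N"
    using N by (intro eq_vecI) (auto simp: V_def)
  moreover have "unit_vec N (d * d) \<noteq> (0\<^sub>v N :: complex vec)"
    using N by simp
  ultimately have "det V = 0"
    using det_0_iff_vec_prod_zero_field[OF car(1)] unit_vec_carrier by blast
  then have "det (V * U) = 0"
    by (simp add: det_mult[OF car])
  moreover have "upper_triangular (V * U)"
    using car by (auto simp: upper_triangular_def VU orth simp del: index_mult_mat(1))
  ultimately have "0 \<in> set (diag_mat (V * U))"
    using det_upper_triangular[of "V * U" N] car by (simp add: prod_list_zero_iff)
  then obtain s where "s < N" "(V * U) $$ (s,s) = 0"
    using car by (auto simp: diag_mat_def)
  then show False
    using VU orth by simp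
qed

section \<open>Commutation rules for products and powers\<close>

lemma mat_left_commute:
  assumes "A * B = B * A" "A \<in> carrier_mat d d" "B \<in> carrier_mat d d" "C \<in> carrier_mat d d"
  shows "A * (B * C) = B * (A * C)"
  using assoc_mult_mat[of A d d B d C d] assoc_mult_mat[of B d d A d C d] assms by simp

lemma mat_commute_mult:
  assumes "A * X = X * A" "B * X = X * B"
    and "A \<in> carrier_mat d d" "B \<in> carrier_mat d d" "X \<in> carrier_mat d d"
  shows "A * B * X = X * (A * B)"
  using assoc_mult_mat[of A d d X d B d] assoc_mult_mat[of X d d A d B d] assms
  by (simp add: assoc_mult_mat[of A d d B d X d])

lemma mat_anticommute_mult:
  fixes A :: "complex mat"
  assumes AX: "A * X = - (X * A)" and BX: "B * X = - (X * B)"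
    and "A \<in> carrier_mat d d" "B \<in> carrier_mat d d" "X \<in> carrier_mat d d"
  shows "A * B * X = X * (A * B)"
proof -
  note car = assms(3-5)
  have "A * B * X = A * (B * X)"
    using car by simp
  also have "\<dots> = - ((A * X) * B)"
    unfolding BX using car by simp
  also have "\<dots> = X * (A * B)"
    unfolding AX using car by simp
  finally show ?thesis .
qed

lemma mat_commute_pow:
  fixes A :: "complex mat"
  assumes "A * X = X * A" "A \<in> carrier_mat d d" "X \<in> carrier_mat d d"
  shows "A ^\<^sub>m p * X = X * A ^\<^sub>m p"
proof (induction p)
  case 0
  show ?case using assms by simp
next
  case (Suc p)
  then show ?case
    using assms by (simp only: pow_mat.simps) (rule mat_commute_mult[of _ _ _ d], auto)
qed

lemma pow_mat_add:
  fixes A :: "complex mat"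
  assumes "A \<in> carrier_mat d d"
  shows "A ^\<^sub>m (p + q) = A ^\<^sub>m p * A ^\<^sub>m q"
proof (induction q)
  case (Suc q)
  then show ?case
    using assms by (simp add: assoc_mult_mat[of _ d d _ d _ d])
qed (use assms in \<open>simp add: right_mult_one_mat[of _ d d]\<close>)

text \<open>\<open>X\<close> is moved once around the trace: past \<open>A\<close> at no cost,
  cyclically to the end, and back past \<open>Y\<close> at the cost of a sign.\<close>

lemma mat_trace_anticommuting_zero:
  assumes "A * X = X * A" "X * Y = - (Y * X)"
    and "A \<in> carrier_mat d d" "X \<in> carrier_mat d d" "Y \<in> carrier_mat d d"
  shows "mat_trace (A * (X * Y)) = 0"
proof -
  have "mat_trace (A * (X * Y)) = mat_trace (X * (A * Y))"
    using assms mat_left_commute by metis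
  also have "\<dots> = mat_trace ((A * Y) * X)"
    using assms by (intro mat_trace_mult_commute) auto
  also have "\<dots> = mat_trace (A * (Y * X))"
    using assms by simp
  also have "\<dots> = - mat_trace (A * (X * Y))"
    using assms by (simp add: mat_trace_uminus[of _ d])
  finally show ?thesis by simp
qed

text \<open>The matrices \<open>W s\<close> are the products of the pairs \<open>X\<^sub>2\<^sub>j X\<^sub>2\<^sub>j\<^sub>+\<^sub>1\<close> over the subsets of \<open>{..<m}\<close>.
  Being even, they commute with all the remaining generators, which makes the induction work.\<close>

lemma clifford_pair_products:
  fixes X :: "nat \<Rightarrow> complex mat"
  assumes X: "\<And>k. k < r \<Longrightarrow> X k \<in> carrier_mat d d"
    and anti: "\<And>k l. k < r \<Longrightarrow> l < r \<Longrightarrow> k \<noteq> l \<Longrightarrow> X k * X l = - (X l * X k)"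
    and sq: "\<And>k. k < r \<Longrightarrow> X k * X k = L"
    and L: "L \<in> carrier_mat d d"
    and trL: "\<And>p. mat_trace (L ^\<^sub>m p) \<noteq> 0"
    and m: "2 * m \<le> r"
  shows "\<exists>W. (\<forall>s<(2::nat) ^ m. W s \<in> carrier_mat d d \<and> W s * L = L * W s \<and>
            (\<forall>k. 2 * m \<le> k \<longrightarrow> k < r \<longrightarrow> W s * X k = X k * W s)) \<and>
          (\<forall>s<(2::nat) ^ m. \<forall>t<2 ^ m. \<forall>p. mat_trace (W s * W t * L ^\<^sub>m p) = 0 \<longleftrightarrow> s \<noteq> t)"
  using m
proof (induction m)
  case 0
  show ?case
    using L X trL by (intro exI[of _ "\<lambda>_. 1\<^sub>m d"]) (auto simp: left_mult_one_mat[of _ d d] right_mult_one_mat[of _ d d])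
next
  case (Suc m)
  have "2 * m \<le> r" using Suc.prems by simp
  from Suc.IH[OF this] obtain W where IH: "(\<forall>s<(2::nat) ^ m. W s \<in> carrier_mat d d \<and> W s * L = L * W s \<and>
            (\<forall>k. 2 * m \<le> k \<longrightarrow> k < r \<longrightarrow> W s * X k = X k * W s)) \<and>
          (\<forall>s<(2::nat) ^ m. \<forall>t<2 ^ m. \<forall>p. mat_trace (W s * W t * L ^\<^sub>m p) = 0 \<longleftrightarrow> s \<noteq> t)"
    by (elim exE)
  have W: "\<And>s. s < 2 ^ m \<Longrightarrow> W s \<in> carrier_mat d d"
    and WL: "\<And>s. s < 2 ^ m \<Longrightarrow> W s * L = L * W s"
    and WX: "\<And>s k. s < 2 ^ m \<Longrightarrow> 2 * m \<le> k \<Longrightarrow> k < r \<Longrightarrow> W s * X k = X k * W s"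
    and tr: "\<And>s t p. s < 2 ^ m \<Longrightarrow> t < 2 ^ m \<Longrightarrow>
        mat_trace (W s * W t * L ^\<^sub>m p) = 0 \<longleftrightarrow> s \<noteq> t"
    using IH by blast+
  define x where "x = X (2 * m)"
  define y where "y = X (2 * m + 1)"
  have xy: "x \<in> carrier_mat d d" "y \<in> carrier_mat d d" "x * x = L" "y * y = L"
    "x * y = - (y * x)"
    using Suc.prems X[of "2 * m"] X[of "2 * m + 1"] sq[of "2 * m"] sq[of "2 * m + 1"]
      anti[of "2 * m" "2 * m + 1"] by (simp_all add: x_def y_def)
  define Q where "Q = x * y"
  have Q: "Q \<in> carrier_mat d d"
    using xy by (simp add: Q_def)
  have LX: "L * X k = X k * L" if "k < r" for k
    using X[OF that] by (simp add: sq[OF that, symmetric])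
  have "x * L = L * x" "y * L = L * y"
    using LX[of "2 * m"] LX[of "2 * m + 1"] Suc.prems by (auto simp: x_def y_def)
  then have QL: "Q * L = L * Q"
    unfolding Q_def using mat_commute_mult xy L by blast
  have WQ: "W s * Q = Q * W s" if "s < 2 ^ m" for s
  proof -
    have "x * W s = W s * x" "y * W s = W s * y"
      using WX[OF that, of "2 * m"] WX[OF that, of "2 * m + 1"] Suc.prems by (auto simp: x_def y_def)
    then show ?thesis
      unfolding Q_def using mat_commute_mult[of x "W s" y d] xy W[OF that] by metis
  qed
  have QX: "Q * X k = X k * Q" if "2 * Suc m \<le> k" "k < r" for k
  proof -
    have Xk: "X k \<in> carrier_mat d d" using X that by simp
    have "y * X k = - (X k * y)" "x * X k = - (X k * x)"
      using anti[of "2 * m" k] anti[of "2 * m + 1" k] that by (auto simp: x_def y_def)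
    then show ?thesis
      unfolding Q_def using mat_anticommute_mult xy(1,2) Xk by blast
  qed
  have QQ: "Q * Q = - (L * L)"
  proof -
    have yx: "y * x = - (x * y)"
      using xy(5) by simp
    have "Q * Q = x * ((y * x) * y)"
      using xy(1,2) by (simp add: Q_def assoc_mult_mat[of _ d d _ d _ d])
    also have "\<dots> = - ((x * x) * (y * y))"
      unfolding yx using xy(1,2) by (simp add: assoc_mult_mat[of _ d d _ d _ d])
    finally show ?thesis using xy(3,4) by simp
  qed
  \<comment> \<open>The index s is a bit mask of pairs; its new top bit decides whether the pair
    \<open>Q\<close> is included.\<close>
  define W' where "W' s = (if s < 2 ^ m then W s else W (s - 2 ^ m) * Q)" for s
  have W'1: "W' s \<in> carrier_mat d d \<and> W' s * L = L * W' s \<and>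
      (\<forall>k. 2 * Suc m \<le> k \<longrightarrow> k < r \<longrightarrow> W' s * X k = X k * W' s)" if "s < 2 ^ Suc m" for s
  proof (cases "s < 2 ^ m")
    case True
    then show ?thesis using W WL WX by (simp add: W'_def)
  next
    case False
    then have s: "s - 2 ^ m < 2 ^ m" using that by simp
    show ?thesis
    proof (intro conjI allI impI)
      show "W' s \<in> carrier_mat d d"
        using False W[OF s] Q by (simp add: W'_def)
      show "W' s * L = L * W' s"
        using False mat_commute_mult[OF WL[OF s] QL W[OF s] Q L] by (simp only: W'_def if_False)
      show "W' s * X k = X k * W' s" if k: "2 * Suc m \<le> k" "k < r" for k
        using False mat_commute_mult[OF WX[OF s _ k(2)] QX[OF k] W[OF s] Q X[OF k(2)]] k(1)
        by (simp only: W'_def if_False) simp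
    qed
  qed
  have W'2: "mat_trace (W' s * W' t * L ^\<^sub>m p) = 0 \<longleftrightarrow> s \<noteq> t"
    if st: "s < 2 ^ Suc m" "t < 2 ^ Suc m" for s t p
  proof -
    define P where "P = L ^\<^sub>m p"
    have P: "P \<in> carrier_mat d d" using L by (simp add: P_def)
    have Px: "P * x = x * P"
      unfolding P_def by (rule mat_commute_pow) (use \<open>x * L = L * x\<close> L xy in auto)
    have PQ: "Q * P = P * Q"
      unfolding P_def by (rule mat_commute_pow[symmetric]) (use QL L Q in auto)
    \<comment> \<open>When exactly one of the two products contains \<open>Q\<close> = x y, the
      remaining factor commutes with \<open>x\<close>, while \<open>x\<close> and \<open>y\<close>
      anticommute.\<close>
    have mixed: "mat_trace (W a * W b * P * Q) = 0" if "a < 2 ^ m" "b < 2 ^ m" for a b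
    proof -
      have ab: "W a * x = x * W a" "W b * x = x * W b"
        using WX[OF that(1), of "2 * m"] WX[OF that(2), of "2 * m"] Suc.prems by (simp_all add: x_def)
      have Wab: "W a * W b \<in> carrier_mat d d"
        using mult_carrier_mat[OF W[OF that(1)] W[OF that(2)]] .
      have "W a * W b * x = x * (W a * W b)"
        using mat_commute_mult[OF ab W[OF that(1)] W[OF that(2)] xy(1)] .
      from mat_commute_mult[OF this Px Wab P xy(1)] show ?thesis
        unfolding Q_def using mat_trace_anticommuting_zero xy(5) mult_carrier_mat[OF Wab P] xy(1,2) by blast
    qed
    consider (ll) "s < 2 ^ m" "t < 2 ^ m" | (lh) "s < 2 ^ m" "\<not> t < 2 ^ m"
      | (hl) "\<not> s < 2 ^ m" "t < 2 ^ m" | (hh) "\<not> s < 2 ^ m" "\<not> t < 2 ^ m"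
      by blast
    then have "mat_trace (W' s * W' t * P) = 0 \<longleftrightarrow> s \<noteq> t"
    proof cases
      case ll
      then show ?thesis using tr unfolding P_def by (simp only: W'_def if_True)
    next
      case lh
      define b where "b = t - 2 ^ m"
      have b: "b < 2 ^ m" using st lh by (simp add: b_def)
      have "W' s * W' t * P = W s * (W b * Q) * P"
        using lh by (simp add: W'_def b_def)
      also have "\<dots> = W s * W b * P * Q"
        using W[OF lh(1)] W[OF b] P Q PQ by (simp add: assoc_mult_mat[of _ d d _ d _ d])
      finally show ?thesis using mixed[OF lh(1) b] lh by auto
    next
      case hl
      define a where "a = s - 2 ^ m"
      have a: "a < 2 ^ m" using st hl by (simp add: a_def)
      have "W' s * W' t * P = W a * Q * W t * P"
        using hl by (simp add: W'_def a_def)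
      also have "\<dots> = W a * W t * P * Q"
        using W[OF a] W[OF hl(2)] P Q PQ mat_left_commute[OF WQ[OF hl(2), symmetric] Q W[OF hl(2)] P]
        by (simp add: assoc_mult_mat[of _ d d _ d _ d])
      finally show ?thesis using mixed[OF a hl(2)] hl by auto
    next
      \<comment> \<open>Both products contain \<open>Q\<close>, and Q^2 = -L^2. The weight therefore
        rises from p to p + 2, which is why the induction hypothesis ranges over all p.\<close>
      case hh
      define a where "a = s - 2 ^ m"
      define b where "b = t - 2 ^ m"
      have a: "a < 2 ^ m" and b: "b < 2 ^ m" using st hh by (auto simp: a_def b_def)
      note car = W[OF a] W[OF b] P Q L
      have LP: "L * P = P * L"
        unfolding P_def by (rule mat_commute_pow[symmetric]) (use L in auto)
      have "W' s * W' t * P = W a * Q * (W b * Q) * P"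
        using hh by (simp add: W'_def a_def b_def)
      also have "\<dots> = W a * (W b * ((Q * Q) * P))"
        using car mat_left_commute[OF WQ[OF b, symmetric] Q W[OF b] mult_carrier_mat[OF Q P]]
        by (simp add: assoc_mult_mat[of _ d d _ d _ d])
      also have "\<dots> = - (W a * W b * (P * L * L))"
        using car LP mat_left_commute[OF LP L P L]
        by (simp add: QQ assoc_mult_mat[of _ d d _ d _ d])
      also have "P * L * L = L ^\<^sub>m (p + 2)"
        by (simp add: P_def numeral_2_eq_2)
      finally have "W' s * W' t * P = - (W a * W b * L ^\<^sub>m (p + 2))" .
      then have "mat_trace (W' s * W' t * P) = - mat_trace (W a * W b * L ^\<^sub>m (p + 2))"
        using car by (simp only: mat_trace_uminus[of _ d] mult_carrier_mat[of _ d d _ d] pow_carrier_mat)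
      then show ?thesis
        using tr[OF a b, of "p + 2"] hh by (simp only: a_def b_def) auto
    qed
    then show ?thesis by (simp only: P_def)
  qed
  show ?case
    using W'1 W'2 by blast
qed

lemma clifford_dim_lower_bound:
  fixes X :: "nat \<Rightarrow> complex mat"
  assumes "\<And>k. k < r \<Longrightarrow> X k \<in> carrier_mat d d"
    and "\<And>k l. k < r \<Longrightarrow> l < r \<Longrightarrow> k \<noteq> l \<Longrightarrow> X k * X l = - (X l * X k)"
    and "\<And>k. k < r \<Longrightarrow> X k * X k = L"
    and L: "L \<in> carrier_mat d d"
    and "\<And>p. mat_trace (L ^\<^sub>m p) \<noteq> 0"
  shows "2 ^ (r div 2) \<le> d * d"
proof -
  have r: "2 * (r div 2) \<le> r" by simp
  have "\<exists>W. (\<forall>s<(2::nat) ^ (r div 2). W s \<in> carrier_mat d d \<and> W s * L = L * W s \<and>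
            (\<forall>k. 2 * (r div 2) \<le> k \<longrightarrow> k < r \<longrightarrow> W s * X k = X k * W s)) \<and>
          (\<forall>s<(2::nat) ^ (r div 2). \<forall>t<2 ^ (r div 2). \<forall>p. mat_trace (W s * W t * L ^\<^sub>m p) = 0 \<longleftrightarrow> s \<noteq> t)"
    by (rule clifford_pair_products; fact assms r)
  then obtain W where W_tr: "(\<forall>s<(2::nat) ^ (r div 2). W s \<in> carrier_mat d d \<and> W s * L = L * W s \<and>
            (\<forall>k. 2 * (r div 2) \<le> k \<longrightarrow> k < r \<longrightarrow> W s * X k = X k * W s)) \<and>
          (\<forall>s<(2::nat) ^ (r div 2). \<forall>t<2 ^ (r div 2). \<forall>p. mat_trace (W s * W t * L ^\<^sub>m p) = 0 \<longleftrightarrow> s \<noteq> t)"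
    by (elim exE)
  then have W: "\<forall>s<(2::nat) ^ (r div 2). W s \<in> carrier_mat d d"
    by blast
  note tr = conjunct2[OF W_tr]
  show ?thesis
  proof (rule trace_orthogonal_card_le)
    fix s t :: nat
    assume st: "s < 2 ^ (r div 2)" "t < 2 ^ (r div 2)"
    then have "W s * W t * L ^\<^sub>m 0 = W s * W t"
      using mult_carrier_mat[of "W s" d d "W t" d] W L by (simp add: right_mult_one_mat[of _ d d])
    then show "mat_trace (W s * W t) = 0 \<longleftrightarrow> s \<noteq> t"
      using tr[rule_format, OF st, of 0] by simp
  qed (use W in blast)
qed

section \<open>Complex positive semidefinite matrices\<close>

text \<open>\<open>(i, False)\<close> and \<open>(i, True)\<close> index the real basis vectors \<open>e\<^sub>i\<close> and \<open>\<i> e\<^sub>i\<close> of \<open>\<complex>\<^sup>d\<close>.\<close>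

definition realify :: "complex mat \<Rightarrow> nat \<times> bool \<Rightarrow> nat \<times> bool \<Rightarrow> real" where
  "realify Q p q = Re (cnj (if snd p then \<i> else 1) * Q $$ (fst p, fst q) * (if snd q then \<i> else 1))"

lemma sum_times_bool:
  "(\<Sum>p\<in>A \<times> (UNIV::bool set). f p) = (\<Sum>i\<in>A. f (i, False) + f (i, True))"
proof -
  have "(\<Sum>p\<in>A \<times> (UNIV::bool set). f p) = (\<Sum>i\<in>A. \<Sum>b\<in>UNIV. f (i, b))"
    by (simp add: sum.cartesian_product)
  then show ?thesis by (simp add: UNIV_bool add.commute)
qed

lemma realify_mult:
  "(\<Sum>q\<in>{..<d} \<times> UNIV. realify Q (i, b) q * x q) =
     Re (cnj (if b then \<i> else 1) * (\<Sum>j<d. Q $$ (i,j) * Complex (x (j, False)) (x (j, True))))"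
proof -
  have "realify Q (i, b) (j, False) * x (j, False) + realify Q (i, b) (j, True) * x (j, True) =
      Re (cnj (if b then \<i> else 1) * (Q $$ (i,j) * Complex (x (j, False)) (x (j, True))))" for j
    by (simp add: realify_def algebra_simps)
  then show ?thesis
    by (simp only: sum_times_bool sum_distrib_left Re_sum)
qed

lemma realify_form:
  "(\<Sum>p\<in>{..<d} \<times> UNIV. \<Sum>q\<in>{..<d} \<times> UNIV. x p * realify Q p q * x q) =
     Re (\<Sum>i<d. \<Sum>j<d. cnj (Complex (x (i, False)) (x (i, True))) * Q $$ (i,j)
       * Complex (x (j, False)) (x (j, True)))"
proof -
  have "x (i, False) * (\<Sum>q\<in>{..<d} \<times> UNIV. realify Q (i, False) q * x q)
      + x (i, True) * (\<Sum>q\<in>{..<d} \<times> UNIV. realify Q (i, True) q * x q)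
      = Re (cnj (Complex (x (i, False)) (x (i, True)))
          * (\<Sum>j<d. Q $$ (i,j) * Complex (x (j, False)) (x (j, True))))" for i
    unfolding realify_mult by simp
  then show ?thesis
    unfolding mult.assoc sum_distrib_left[symmetric] Re_sum
    by (subst sum_times_bool) simp
qed

lemma herm_psd_form_nonneg:
  assumes "herm_psd d P"
  shows "0 \<le> Re (\<Sum>i<d. \<Sum>j<d. cnj (z i) * P $$ (i,j) * z j)"
proof -
  have "0 \<le> Re (\<Sum>i<d. \<Sum>j<d. cnj (vec d z $ i) * P $$ (i,j) * vec d z $ j)"
    using assms vec_carrier[of d z] unfolding herm_psd_def by blast
  then show ?thesis by simp
qed

text \<open>This transfers the null vector and Gram lemmas for real forms to complex matrices; the
  free index set of \<open>psd_form\<close> serves this purpose.\<close>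

lemma psd_form_realify:
  assumes "herm_psd d Q"
  shows "psd_form ({..<d} \<times> UNIV) (realify Q)"
  unfolding psd_form_def
proof (intro conjI ballI allI)
  fix p q :: "nat \<times> bool"
  assume "p \<in> {..<d} \<times> UNIV" "q \<in> {..<d} \<times> UNIV"
  then have "fst p < d" "fst q < d"
    by auto
  then have "Q $$ (fst p, fst q) = cnj (Q $$ (fst q, fst p))"
    using assms unfolding herm_psd_def by blast
  then show "realify Q p q = realify Q q p"
    by (simp add: realify_def)
next
  fix x :: "nat \<times> bool \<Rightarrow> real"
  have "0 \<le> Re (\<Sum>i<d. \<Sum>j<d. cnj (Complex (x (i, False)) (x (i, True))) * Q $$ (i,j)
       * Complex (x (j, False)) (x (j, True)))"
    by (rule herm_psd_form_nonneg[OF assms])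
  also have "\<dots> = (\<Sum>p\<in>{..<d} \<times> UNIV. \<Sum>q\<in>{..<d} \<times> UNIV. x p * realify Q p q * x q)"
    by (rule realify_form[symmetric])
  finally show "0 \<le> (\<Sum>p\<in>{..<d} \<times> UNIV. \<Sum>q\<in>{..<d} \<times> UNIV. x p * realify Q p q * x q)" .
qed simp

text \<open>In real coordinates, the index (i, False) yields the real part of (P z)_i and (i, True)
  its imaginary part.\<close>

lemma herm_psd_null:
  assumes "herm_psd d P" "i < d"
    and "Re (\<Sum>i<d. \<Sum>j<d. cnj (z i) * P $$ (i,j) * z j) = 0"
  shows "(\<Sum>j<d. P $$ (i,j) * z j) = 0"
proof -
  define x where "x p = (if snd p then Im (z (fst p)) else Re (z (fst p)))" for p :: "nat \<times> bool"
  have z: "Complex (x (j, False)) (x (j, True)) = z j" for j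
    by (simp add: x_def)
  have "Re (cnj (if b then \<i> else 1) * (\<Sum>j<d. P $$ (i,j) * z j)) = 0" for b
    using psd_form_null[OF psd_form_realify[OF assms(1)], of "(i, b)" x] assms(2,3)
    by (simp only: realify_form realify_mult z) simp
  from this[of False] this[of True] show ?thesis
    by (simp add: complex_eq_iff)
qed

text \<open>Each real Gram vector of length 2d is read as a complex vector x + \<i> y. The factor 2
  arises because Re Q and Im Q each occur in two blocks of \<open>realify Q\<close>.\<close>

lemma herm_psd_gram:
  assumes "herm_psd d Q"
  obtains s q where
    "\<And>i j. i < d \<Longrightarrow> j < d \<Longrightarrow> 2 * Q $$ (i,j) = (\<Sum>k<(s::nat). q k i * cnj (q k j))"
proof -
  obtain s u where u: "\<And>a b. a \<in> {..<d} \<times> UNIV \<Longrightarrow> b \<in> {..<d} \<times> UNIV \<Longrightarrow>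
      realify Q a b = (\<Sum>k<(s::nat). u k a * u k b)"
    using psd_form_gram[OF psd_form_realify[OF assms]] by metis
  have "2 * Q $$ (i,j) = (\<Sum>k<s. Complex (u k (i, False)) (u k (i, True))
      * cnj (Complex (u k (j, False)) (u k (j, True))))" if "i < d" "j < d" for i j
  proof -
    have "realify Q (i,False) (j,False) + realify Q (i,True) (j,True) =
        (\<Sum>k<s. u k (i,False) * u k (j,False) + u k (i,True) * u k (j,True))"
      "realify Q (i,True) (j,False) - realify Q (i,False) (j,True) =
        (\<Sum>k<s. u k (i,True) * u k (j,False) - u k (i,False) * u k (j,True))"
      using that by (simp_all add: u sum.distrib sum_subtractf)
    then show ?thesis
      by (simp add: realify_def complex_eq_iff algebra_simps)
  qed
  then show thesis by (rule that)
qed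

text \<open>With 2 Q = sum_k q_k q_k^*, the trace 2 Tr (P Q) is the sum of the nonnegative numbers
  q_k^* P q_k. All of them vanish, so P q_k = 0 for every k and hence P Q = 0.\<close>

lemma herm_psd_mult_zero:
  assumes P: "herm_psd d P" and Q: "herm_psd d Q" and tr: "mat_trace (P * Q) = 0"
  shows "P * Q = 0\<^sub>m d d"
proof -
  have car: "P \<in> carrier_mat d d" "Q \<in> carrier_mat d d"
    using P Q by (auto simp: herm_psd_def)
  obtain s q where q: "\<And>i j. i < d \<Longrightarrow> j < d \<Longrightarrow> 2 * Q $$ (i,j) = (\<Sum>k<(s::nat). q k i * cnj (q k j))"
    using herm_psd_gram[OF Q] by metis
  define F where "F k = (\<Sum>i<d. \<Sum>j<d. cnj (q k i) * P $$ (i,j) * q k j)" for k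
  have Fpos: "0 \<le> Re (F k)" for k
    unfolding F_def by (rule herm_psd_form_nonneg[OF P])
  have "2 * mat_trace (P * Q) = (\<Sum>i<d. \<Sum>j<d. P $$ (i,j) * (2 * Q $$ (j,i)))"
    by (simp add: mat_trace_mult[OF car] sum_distrib_left mult_ac)
  also have "\<dots> = (\<Sum>i<d. \<Sum>j<d. \<Sum>k<s. cnj (q k i) * P $$ (i,j) * q k j)"
    by (intro sum.cong refl) (simp add: q sum_distrib_left mult_ac)
  also have "\<dots> = (\<Sum>k<s. F k)"
    unfolding F_def by (rule sum_rotate)
  finally have "(\<Sum>k<s. Re (F k)) = 0"
    using tr by (simp flip: Re_sum)
  then have F0: "Re (F k) = 0" if "k < s" for k
    using that Fpos by (subst (asm) sum_nonneg_eq_0_iff) auto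
  have Pq: "(\<Sum>j<d. P $$ (i,j) * q k j) = 0" if "i < d" "k < s" for i k
    by (rule herm_psd_null[OF P that(1)]) (use F0[OF that(2)] in \<open>simp add: F_def\<close>)
  show ?thesis
  proof (rule eq_matI)
    fix i l assume "i < dim_row (0\<^sub>m d d :: complex mat)" "l < dim_col (0\<^sub>m d d :: complex mat)"
    then have il: "i < d" "l < d" by auto
    have "2 * (P * Q) $$ (i,l) = (\<Sum>j<d. P $$ (i,j) * (2 * Q $$ (j,l)))"
      using il car by (simp add: scalar_prod_def atLeast0LessThan sum_distrib_left mult_ac)
    also have "\<dots> = (\<Sum>j<d. \<Sum>k<s. P $$ (i,j) * q k j * cnj (q k l))"
      using il by (intro sum.cong refl) (simp add: q sum_distrib_left mult_ac)
    also have "\<dots> = (\<Sum>k<s. (\<Sum>j<d. P $$ (i,j) * q k j) * cnj (q k l))"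
      by (subst sum.swap) (simp add: sum_distrib_right)
    also have "\<dots> = 0"
      using Pq il by simp
    finally show "(P * Q) $$ (i,l) = 0\<^sub>m d d $$ (i,l)"
      using il by simp
  qed (use car in auto)
qed

section \<open>Clifford representation of Gram-Lorentz matrices\<close>

text \<open>\<open>clifford_mat r u\<close> is \<open>\<Sum>k<r. u k \<gamma>\<^sub>k\<close> for a family of real symmetric Clifford generators
  of size \<open>2 ^ r\<close>.\<close>

fun clifford_mat :: "nat \<Rightarrow> (nat \<Rightarrow> real) \<Rightarrow> complex mat" where
  "clifford_mat 0 u = 0\<^sub>m 1 1"
| "clifford_mat (Suc r) u = four_block_mat (clifford_mat r u) (of_real (u r) \<cdot>\<^sub>m 1\<^sub>m (2 ^ r))
     (of_real (u r) \<cdot>\<^sub>m 1\<^sub>m (2 ^ r)) (- clifford_mat r u)"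

lemma clifford_mat_carrier [simp]: "clifford_mat r u \<in> carrier_mat (2 ^ r) (2 ^ r)"
  by (induction r) (auto simp: mult_2)

lemma clifford_mat_dim [simp]:
  "dim_row (clifford_mat r u) = 2 ^ r" "dim_col (clifford_mat r u) = 2 ^ r"
  using clifford_mat_carrier[of r u] by (auto simp del: clifford_mat_carrier)

lemma clifford_mat_hermitian:
  "i < 2 ^ r \<Longrightarrow> j < 2 ^ r \<Longrightarrow> cnj (clifford_mat r u $$ (j,i)) = clifford_mat r u $$ (i,j)"
proof (induction r arbitrary: i j)
  case (Suc r)
  have "k - 2 ^ r < 2 ^ r" if "k < 2 ^ Suc r" for k :: nat
    using that by simp
  with Suc show ?case
    by (auto simp: not_less)
qed simp

text \<open>In the block square the off-diagonal terms cancel, because the scalar block commutes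
  with both A and -A; each diagonal block gains \<open>(u r)\<^sup>2\<close>.\<close>

lemma clifford_mat_square:
  "clifford_mat r u * clifford_mat r u = of_real (\<Sum>k<r. (u k)\<^sup>2) \<cdot>\<^sub>m 1\<^sub>m (2 ^ r)"
proof (induction r)
  case 0
  show ?case by (intro eq_matI) auto
next
  case (Suc r)
  let ?A = "clifford_mat r u" and ?I = "of_real (u r) \<cdot>\<^sub>m 1\<^sub>m (2 ^ r) :: complex mat"
  have A: "?A \<in> carrier_mat (2 ^ r) (2 ^ r)" by simp
  have I: "?I \<in> carrier_mat (2 ^ r) (2 ^ r)" by simp
  have nA: "- ?A \<in> carrier_mat (2 ^ r) (2 ^ r)" by simp
  have "clifford_mat (Suc r) u * clifford_mat (Suc r) u = four_block_mat
      (?A * ?A + ?I * ?I) (?A * ?I + ?I * - ?A) (?I * ?A + - ?A * ?I) (?I * ?I + - ?A * - ?A)"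
    using mult_four_block_mat[OF A I I nA A I I nA] by simp
  also have "?A * ?I = of_real (u r) \<cdot>\<^sub>m ?A"
    using A by (simp add: mult_smult_distrib[of _ "2 ^ r" "2 ^ r" _ "2 ^ r"])
  also have "?I * - ?A = - (of_real (u r) \<cdot>\<^sub>m ?A)"
    using A by (simp add: mult_smult_assoc_mat[of _ "2 ^ r" "2 ^ r" _ "2 ^ r"])
  also have "?I * ?A = of_real (u r) \<cdot>\<^sub>m ?A"
    using A by (simp add: mult_smult_assoc_mat[of _ "2 ^ r" "2 ^ r" _ "2 ^ r"])
  also have "- ?A * ?I = - (of_real (u r) \<cdot>\<^sub>m ?A)"
    using A by (simp only: uminus_mult_left_mat index_smult_mat index_one_mat clifford_mat_dim
        mult_smult_distrib[of _ "2 ^ r" "2 ^ r" _ "2 ^ r"] one_carrier_mat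
        right_mult_one_mat[of _ "2 ^ r" "2 ^ r"])
  also have "- ?A * - ?A = ?A * ?A"
    using A by simp
  also have "?I * ?I = of_real ((u r)\<^sup>2) \<cdot>\<^sub>m 1\<^sub>m (2 ^ r)"
    by (intro eq_matI) (auto simp: power2_eq_square)
  finally show ?case
    unfolding Suc.IH by (intro eq_matI) (auto simp: algebra_simps)
qed

section \<open>Scalars, traces and positivity of the Clifford images\<close>

lemma smult_smult_mat:
  fixes A :: "'a::semigroup_mult mat"
  shows "a \<cdot>\<^sub>m (b \<cdot>\<^sub>m A) = (a * b) \<cdot>\<^sub>m A"
  by (intro eq_matI) (auto simp: mult.assoc)

lemma smult_mult_smult_mat:
  fixes A :: "'a::comm_ring_1 mat"
  assumes "A \<in> carrier_mat d d" "B \<in> carrier_mat d d"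
  shows "(a \<cdot>\<^sub>m A) * (b \<cdot>\<^sub>m B) = (a * b) \<cdot>\<^sub>m (A * B)"
  using assms by (simp add: mult_smult_distrib[of _ d d _ d] mult_smult_assoc_mat[of _ d d _ d]
      smult_smult_mat mult.commute)

lemma mat_trace_add:
  assumes "A \<in> carrier_mat d d" "B \<in> carrier_mat d d"
  shows "mat_trace (A + B) = mat_trace A + mat_trace B"
  using assms by (simp add: mat_trace_def sum.distrib)

lemma mat_trace_smult:
  assumes "A \<in> carrier_mat d d"
  shows "mat_trace (c \<cdot>\<^sub>m A) = c * mat_trace A"
  using assms by (simp add: mat_trace_def sum_distrib_left)

lemma mat_trace_four_block:
  assumes "A \<in> carrier_mat p p" "D \<in> carrier_mat q q"
  shows "mat_trace (four_block_mat A B C D) = mat_trace A + mat_trace D"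
proof -
  have "mat_trace (four_block_mat A B C D) =
      (\<Sum>k<p + q. if k < p then A $$ (k,k) else D $$ (k - p,k - p))"
    using assms by (auto simp: mat_trace_def intro!: sum.cong)
  also have "\<dots> = (\<Sum>k<p. A $$ (k,k)) + (\<Sum>k<q. D $$ (k,k))"
    by (induction q) auto
  finally show ?thesis
    using assms by (simp add: mat_trace_def)
qed

lemma mat_trace_clifford_mat: "mat_trace (clifford_mat r u) = 0"
proof (cases r)
  case (Suc k)
  then show ?thesis
    by (simp add: mat_trace_four_block[of _ "2 ^ k" _ "2 ^ k"] mat_trace_uminus[of _ "2 ^ k"])
qed (simp add: mat_trace_def)

lemma mat_trace_clifford_mat_mult:
  "mat_trace (clifford_mat r u * clifford_mat r v) = of_real (2 ^ r * (\<Sum>k<r. u k * v k))"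
proof (induction r)
  case 0
  show ?case by (simp add: mat_trace_def)
next
  case (Suc r)
  let ?A = "clifford_mat r u" and ?I = "of_real (u r) \<cdot>\<^sub>m 1\<^sub>m (2 ^ r) :: complex mat"
  let ?B = "clifford_mat r v" and ?J = "of_real (v r) \<cdot>\<^sub>m 1\<^sub>m (2 ^ r) :: complex mat"
  have car: "?A \<in> carrier_mat (2 ^ r) (2 ^ r)" "?I \<in> carrier_mat (2 ^ r) (2 ^ r)"
    "?B \<in> carrier_mat (2 ^ r) (2 ^ r)" "?J \<in> carrier_mat (2 ^ r) (2 ^ r)"
    "- ?A \<in> carrier_mat (2 ^ r) (2 ^ r)" "- ?B \<in> carrier_mat (2 ^ r) (2 ^ r)" by simp_all
  have IJ: "mat_trace (?I * ?J) = of_real (2 ^ r * (u r * v r))"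
  proof -
    have "?I * ?J = of_real (u r * v r) \<cdot>\<^sub>m 1\<^sub>m (2 ^ r)"
      by (intro eq_matI) auto
    then show ?thesis by (simp add: mat_trace_def)
  qed
  have "clifford_mat (Suc r) u * clifford_mat (Suc r) v = four_block_mat
      (?A * ?B + ?I * ?J) (?A * ?J + ?I * - ?B) (?I * ?B + - ?A * ?J) (?I * ?J + - ?A * - ?B)"
    using mult_four_block_mat[OF car(1,2,2,5) car(3,4,4,6)] by simp
  then have "mat_trace (clifford_mat (Suc r) u * clifford_mat (Suc r) v) =
      mat_trace (?A * ?B + ?I * ?J) + mat_trace (?I * ?J + - ?A * - ?B)"
    using car by (simp only: mat_trace_four_block[of _ "2 ^ r" _ "2 ^ r"] add_carrier_mat
        mult_carrier_mat[of _ "2 ^ r" "2 ^ r" _ "2 ^ r"])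
  also have "\<dots> = (mat_trace (?A * ?B) + mat_trace (?I * ?J)) + (mat_trace (?I * ?J) + mat_trace (?A * ?B))"
  proof -
    have "- ?A * - ?B = ?A * ?B" by simp
    then show ?thesis
      using car by (simp only: mat_trace_add[of _ "2 ^ r"] mult_carrier_mat[of _ "2 ^ r" "2 ^ r" _ "2 ^ r"])
  qed
  finally show ?case
    unfolding Suc.IH IJ by (simp add: algebra_simps)
qed

text \<open>For Hermitian P = c P^2 one has v^* P v = c \<parallel>P v\<parallel>^2, with
  \<open>w\<close> = P v in the proof.\<close>

lemma herm_psd_of_square:
  assumes "P \<in> carrier_mat d d" and c: "c \<ge> 0"
    and herm: "\<And>i j. i < d \<Longrightarrow> j < d \<Longrightarrow> P $$ (i,j) = cnj (P $$ (j,i))"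
    and sq: "P = of_real c \<cdot>\<^sub>m (P * P)"
  shows "herm_psd d P"
  unfolding herm_psd_def
proof (intro conjI allI impI ballI)
  fix v :: "complex vec"
  define w where "w k = (\<Sum>j<d. P $$ (k,j) * v $ j)" for k
  have "(\<Sum>i<d. \<Sum>j<d. cnj (v $ i) * P $$ (i,j) * v $ j)
      = (\<Sum>i<d. \<Sum>j<d. \<Sum>k<d. of_real c * (cnj (v $ i) * P $$ (i,k) * (P $$ (k,j) * v $ j)))"
  proof (intro sum.cong refl)
    fix i j assume "i \<in> {..<d}" "j \<in> {..<d}"
    then have "(of_real c \<cdot>\<^sub>m (P * P)) $$ (i,j) = of_real c * (\<Sum>k<d. P $$ (i,k) * P $$ (k,j))"
      using assms(1) by (simp add: scalar_prod_def atLeast0LessThan)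
    moreover have "P $$ (i,j) = (of_real c \<cdot>\<^sub>m (P * P)) $$ (i,j)"
      by (rule arg_cong[OF sq])
    ultimately show "cnj (v $ i) * P $$ (i,j) * v $ j =
        (\<Sum>k<d. of_real c * (cnj (v $ i) * P $$ (i,k) * (P $$ (k,j) * v $ j)))"
      by (simp only: sum_distrib_left sum_distrib_right) (simp only: mult_ac)
  qed
  also have "\<dots> = (\<Sum>k<d. \<Sum>i<d. \<Sum>j<d. of_real c * (cnj (v $ i) * P $$ (i,k) * (P $$ (k,j) * v $ j)))"
    by (rule sum_rotate)
  also have "\<dots> = (\<Sum>k<d. of_real c * (cnj (w k) * w k))"
  proof (intro sum.cong refl)
    fix k assume "k \<in> {..<d}"
    then have cw: "cnj (w k) = (\<Sum>i<d. cnj (v $ i) * P $$ (i,k))"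
      unfolding w_def cnj_sum by (intro sum.cong refl) (simp add: herm[of _ k] mult.commute)
    have "cnj (w k) * w k = (\<Sum>i<d. \<Sum>j<d. cnj (v $ i) * P $$ (i,k) * (P $$ (k,j) * v $ j))"
      unfolding cw unfolding w_def by (rule sum_product)
    then show "(\<Sum>i<d. \<Sum>j<d. of_real c * (cnj (v $ i) * P $$ (i,k) * (P $$ (k,j) * v $ j))) =
        of_real c * (cnj (w k) * w k)"
      by (simp only: sum_distrib_left)
  qed
  also have "\<dots> = of_real (\<Sum>k<d. c * (cmod (w k))\<^sup>2)"
  proof -
    have "cnj z * z = of_real ((cmod z)\<^sup>2)" for z
      by (simp only: complex_norm_square mult.commute)
    then show ?thesis by (simp only: of_real_mult of_real_sum)
  qed
  finally show "0 \<le> Re (\<Sum>i<d. \<Sum>j<d. cnj (v $ i) * P $$ (i,j) * v $ j)"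
    using c by (simp only: Re_complex_of_real) (intro sum_nonneg mult_nonneg_nonneg, auto)
qed (use assms(1) herm in blast)+

text \<open>The images of the Lorentz vectors \<open>(1, \<plusminus>u) / 2\<close> with \<open>\<parallel>u\<parallel> = 1\<close>; up to the factor these are
  complementary projections.\<close>

definition clifford_proj :: "nat \<Rightarrow> (nat \<Rightarrow> real) \<Rightarrow> complex mat" where
  "clifford_proj r u = of_real (1 / (2 * sqrt (2 ^ r))) \<cdot>\<^sub>m (1\<^sub>m (2 ^ r) + clifford_mat r u)"

lemma herm_psd_clifford_proj:
  assumes "(\<Sum>k<r. (u k)\<^sup>2) = 1"
  shows "herm_psd (2 ^ r) (clifford_proj r u)"
\<comment> \<open>With D = 2^r and A^2 = I one has (I + A)^2 = 2 (I + A), so the square of (I + A) /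
  (2 sqrt D) is that matrix divided by sqrt D.\<close>
proof (rule herm_psd_of_square[where c = "sqrt (2 ^ r)"])
  let ?A = "clifford_mat r u" and ?I = "1\<^sub>m (2 ^ r) :: complex mat"
  let ?c = "1 / (2 * sqrt (2 ^ r))"
  have car: "?I \<in> carrier_mat (2 ^ r) (2 ^ r)" "?A \<in> carrier_mat (2 ^ r) (2 ^ r)" by simp_all
  have "(?I + ?A) * (?I + ?A) = ?I * ?I + ?A * ?I + (?I * ?A + ?A * ?A)"
    using car by (simp only: add_mult_distrib_mat[of _ "2 ^ r" "2 ^ r" _ _ "2 ^ r"]
        mult_add_distrib_mat[of _ "2 ^ r" "2 ^ r" _ "2 ^ r"] add_carrier_mat)
  also have "\<dots> = 2 \<cdot>\<^sub>m (?I + ?A)"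
    using clifford_mat_square[of r u] assms car
    by (intro eq_matI) (auto simp del: index_mult_mat simp: left_mult_one_mat[of _ "2 ^ r" "2 ^ r"]
        right_mult_one_mat[of _ "2 ^ r" "2 ^ r"])
  finally have sq: "(?I + ?A) * (?I + ?A) = 2 \<cdot>\<^sub>m (?I + ?A)" .
  have "clifford_proj r u * clifford_proj r u = of_real (?c * ?c) \<cdot>\<^sub>m ((?I + ?A) * (?I + ?A))"
    unfolding clifford_proj_def
    using car by (simp only: of_real_mult smult_mult_smult_mat[of _ "2 ^ r"] add_carrier_mat)
  then have "clifford_proj r u * clifford_proj r u = of_real (2 * (?c * ?c)) \<cdot>\<^sub>m (?I + ?A)"
    unfolding sq by (simp add: smult_smult_mat)
  moreover have "sqrt (2 ^ r) * (2 * (?c * ?c)) = ?c"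
    by (simp add: field_simps)
  ultimately show "clifford_proj r u = of_real (sqrt (2 ^ r)) \<cdot>\<^sub>m (clifford_proj r u * clifford_proj r u)"
    unfolding clifford_proj_def by (simp only: smult_smult_mat of_real_mult[symmetric])
qed (auto simp: clifford_proj_def clifford_mat_hermitian)

text \<open>The linear terms are traceless, and the normalization 1 / (4 D) cancels the trace D =
  2^r of the identity.\<close>

lemma mat_trace_clifford_proj:
  "mat_trace (clifford_proj r u * clifford_proj r v) = of_real ((1 + (\<Sum>k<r. u k * v k)) / 4)"
proof -
  let ?A = "clifford_mat r u" and ?B = "clifford_mat r v" and ?I = "1\<^sub>m (2 ^ r) :: complex mat"
  let ?c = "1 / (2 * sqrt (2 ^ r))"
  have car: "?I \<in> carrier_mat (2 ^ r) (2 ^ r)" "?A \<in> carrier_mat (2 ^ r) (2 ^ r)"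
    "?B \<in> carrier_mat (2 ^ r) (2 ^ r)" "?A * ?B \<in> carrier_mat (2 ^ r) (2 ^ r)"
    using mult_carrier_mat[OF clifford_mat_carrier clifford_mat_carrier] by auto
  have "clifford_proj r u * clifford_proj r v = of_real (?c * ?c) \<cdot>\<^sub>m ((?I + ?A) * (?I + ?B))"
    unfolding clifford_proj_def
    using car by (simp only: of_real_mult smult_mult_smult_mat[of _ "2 ^ r"] add_carrier_mat)
  also have "(?I + ?A) * (?I + ?B) = (?I + ?A) + (?B + ?A * ?B)"
    using car by (simp only: add_mult_distrib_mat[of _ "2 ^ r" "2 ^ r" _ _ "2 ^ r"]
        mult_add_distrib_mat[of _ "2 ^ r" "2 ^ r" _ "2 ^ r"] add_carrier_mat
        left_mult_one_mat[of _ "2 ^ r" "2 ^ r"] right_mult_one_mat[of _ "2 ^ r" "2 ^ r"])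
  finally have "mat_trace (clifford_proj r u * clifford_proj r v) = of_real (?c * ?c) *
      (mat_trace ?I + mat_trace ?A + (mat_trace ?B + mat_trace (?A * ?B)))"
    using car by (simp only: mat_trace_smult[of _ "2 ^ r"] mat_trace_add[of _ "2 ^ r"] add_carrier_mat)
  also have "mat_trace ?I = 2 ^ r"
    by (simp add: mat_trace_def)
  finally have tr: "mat_trace (clifford_proj r u * clifford_proj r v) = of_real (?c * ?c) *
      (2 ^ r + mat_trace ?A + (mat_trace ?B + mat_trace (?A * ?B)))" .
  show ?thesis
  proof -
    have "of_real (?c * ?c) * (2 ^ r + 0 + (0 + of_real (2 ^ r * (\<Sum>k<r. u k * v k)))) =
        complex_of_real ((?c * ?c) * (2 ^ r + 2 ^ r * (\<Sum>k<r. u k * v k)))"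
      by simp
    also have "(?c * ?c) * (2 ^ r + 2 ^ r * (\<Sum>k<r. u k * v k)) = (1 + (\<Sum>k<r. u k * v k)) / 4"
      by (simp add: field_simps)
    finally show ?thesis
      unfolding tr mat_trace_clifford_mat mat_trace_clifford_mat_mult .
  qed
qed

section \<open>Lower bound on the factorization size\<close>

definition herm_mat :: "nat \<Rightarrow> complex mat \<Rightarrow> bool" where
  "herm_mat d A \<longleftrightarrow> A \<in> carrier_mat d d \<and> (\<forall>i<d. \<forall>j<d. cnj (A $$ (j,i)) = A $$ (i,j))"

lemma herm_matD:
  assumes "herm_mat d A"
  shows "A \<in> carrier_mat d d" "i < d \<Longrightarrow> j < d \<Longrightarrow> cnj (A $$ (j,i)) = A $$ (i,j)"
  using assms by (auto simp: herm_mat_def)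

lemma herm_psd_imp_herm_mat: "herm_psd d P \<Longrightarrow> herm_mat d P"
  unfolding herm_psd_def herm_mat_def by metis

lemma herm_mat_add: "herm_mat d A \<Longrightarrow> herm_mat d B \<Longrightarrow> herm_mat d (A + B)"
  by (auto simp: herm_mat_def)

lemma herm_mat_minus: "herm_mat d A \<Longrightarrow> herm_mat d B \<Longrightarrow> herm_mat d (A - B)"
  by (auto simp: herm_mat_def)

lemma mat_trace_zero: "mat_trace (0\<^sub>m d d) = 0"
  by (simp add: mat_trace_def)

text \<open>For Hermitian A, Tr (A^2) is the squared Frobenius norm. This is how the prescribed
  traces become matrix identities below.\<close>

lemma herm_mat_trace_square_zero:
  assumes A: "herm_mat d A" and tr: "mat_trace (A * A) = 0"
  shows "A = 0\<^sub>m d d"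
proof -
  note car = herm_matD(1)[OF A]
  have "mat_trace (A * A) = (\<Sum>i<d. \<Sum>j<d. A $$ (i,j) * cnj (A $$ (i,j)))"
    unfolding mat_trace_mult[OF car car] using herm_matD(2)[OF A]
    by (intro sum.cong refl) simp
  also have "\<dots> = of_real (\<Sum>i<d. \<Sum>j<d. (cmod (A $$ (i,j)))\<^sup>2)"
    by (simp only: complex_norm_square of_real_sum)
  finally have "(\<Sum>i<d. \<Sum>j<d. (cmod (A $$ (i,j)))\<^sup>2) = 0"
    using tr by (metis of_real_eq_0_iff)
  then have "A $$ (i,j) = 0" if "i < d" "j < d" for i j
    using that by (simp add: sum_nonneg_eq_0_iff sum_nonneg)
  then show ?thesis
    using car by (intro eq_matI) auto
qed

lemma herm_mat_pow:
  assumes A: "herm_mat d A"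
  shows "herm_mat d (A ^\<^sub>m p)"
proof (induction p)
  case 0
  show ?case using herm_matD(1)[OF A] by (auto simp: herm_mat_def)
next
  case (Suc p)
  note car = herm_matD(1)[OF A] herm_matD(1)[OF Suc]
  have "cnj ((A ^\<^sub>m Suc p) $$ (j,i)) = (A ^\<^sub>m Suc p) $$ (i,j)" if "i < d" "j < d" for i j
  proof -
    have "cnj ((A ^\<^sub>m Suc p) $$ (j,i)) = (\<Sum>k<d. cnj ((A ^\<^sub>m p) $$ (j,k)) * cnj (A $$ (k,i)))"
      using that car by (simp add: scalar_prod_def atLeast0LessThan)
    also have "\<dots> = (\<Sum>k<d. A $$ (i,k) * (A ^\<^sub>m p) $$ (k,j))"
      using that by (intro sum.cong refl) (simp add: herm_matD(2)[OF A] herm_matD(2)[OF Suc])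
    also have "\<dots> = (A * A ^\<^sub>m p) $$ (i,j)"
      using that car by (simp add: scalar_prod_def atLeast0LessThan)
    also have "A * A ^\<^sub>m p = A ^\<^sub>m Suc p"
      using mat_commute_pow[OF refl car(1) car(1)] by simp
    finally show ?thesis .
  qed
  then show ?case
    using pow_carrier_mat[OF car(1), of "Suc p"] unfolding herm_mat_def by blast
qed

text \<open>Squaring preserves being Hermitian and nonzero, so every A^(2^j) is nonzero; A^p = 0
  would force A^(2^p) = 0, as p \<le> 2^p.\<close>

lemma herm_mat_pow_nonzero:
  assumes A: "herm_mat d A" and nz: "A \<noteq> 0\<^sub>m d d"
  shows "A ^\<^sub>m p \<noteq> 0\<^sub>m d d"
proof
  note car = herm_matD(1)[OF A]
  have "A ^\<^sub>m (2 ^ j) \<noteq> 0\<^sub>m d d" for j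
  proof (induction j)
    case 0
    then show ?case using nz car by (simp add: left_mult_one_mat[of _ d d])
  next
    case (Suc j)
    have "A ^\<^sub>m (2 ^ Suc j) = A ^\<^sub>m (2 ^ j) * A ^\<^sub>m (2 ^ j)"
      using pow_mat_add[OF car, of "2 ^ j" "2 ^ j"] by (simp add: mult_2)
    then show ?case
      using Suc herm_mat_trace_square_zero[OF herm_mat_pow[OF A]] mat_trace_zero by metis
  qed
  moreover assume "A ^\<^sub>m p = 0\<^sub>m d d"
  moreover have "A ^\<^sub>m (2 ^ p) = A ^\<^sub>m p * A ^\<^sub>m (2 ^ p - p)"
    using pow_mat_add[OF car, of p "2 ^ p - p"] by (simp add: less_imp_le)
  ultimately show False
    using left_mult_zero_mat[OF pow_carrier_mat[OF car]] by metis
qed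

text \<open>(K^2)^p = (K^p)^2, whose trace is the squared Frobenius norm of K^p.\<close>

lemma mat_trace_square_pow_nonzero:
  assumes K: "herm_mat d K" and nz: "K \<noteq> 0\<^sub>m d d"
  shows "mat_trace ((K * K) ^\<^sub>m p) \<noteq> 0"
proof -
  note car = herm_matD(1)[OF K]
  have "(K * K) ^\<^sub>m p = K ^\<^sub>m p * K ^\<^sub>m p"
  proof (induction p)
    case 0
    show ?case using car by simp
  next
    case (Suc p)
    have "K ^\<^sub>m Suc p * K ^\<^sub>m Suc p = K ^\<^sub>m p * (K * (K ^\<^sub>m p * K))"
      using car by (simp add: assoc_mult_mat[of _ d d _ d _ d] mult_carrier_mat[of _ d d _ d])
    also have "K * (K ^\<^sub>m p * K) = K ^\<^sub>m p * (K * K)"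
      using mat_left_commute[of K "K ^\<^sub>m p" d K] mat_commute_pow[OF refl car car] car by simp
    finally show ?case
      using car Suc by (simp add: assoc_mult_mat[of _ d d _ d _ d] mult_carrier_mat[of _ d d _ d])
  qed
  then show ?thesis
    using herm_mat_trace_square_zero[OF herm_mat_pow[OF K]] herm_mat_pow_nonzero[OF K nz] by metis
qed

text \<open>\<open>T\<close> is symmetric rather than Hermitian and the \<open>u k i\<close> are
  real, so the real and the imaginary part of \<open>T\<close> each satisfy the real
  hypotheses.\<close>

lemma extreme_elliptope_perturbation_complex:
  fixes T :: "nat \<Rightarrow> nat \<Rightarrow> complex"
  assumes ext: "extreme_mat (elliptope n) C"
    and orth: "\<And>k l. k < (r::nat) \<Longrightarrow> l < r \<Longrightarrow> (\<Sum>i<n. f k i * u l i) = (if k = l then 1 else 0)"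
    and dec: "\<And>i j. i < n \<Longrightarrow> j < n \<Longrightarrow> C $$ (i,j) = (\<Sum>k<r. u k i * u k j)"
    and Tsym: "\<And>k l. k < r \<Longrightarrow> l < r \<Longrightarrow> T k l = T l k"
    and T0: "\<And>i. i < n \<Longrightarrow> (\<Sum>k<r. \<Sum>l<r. of_real (u k i) * T k l * of_real (u l i)) = 0"
    and kl: "k < r" "l < r"
  shows "T k l = 0"
proof (rule complex_eqI)
  have "(\<Sum>k<r. \<Sum>l<r. u k i * Re (T k l) * u l i) = 0" if "i < n" for i
    using arg_cong[OF T0[OF that], of Re] by simp
  from extreme_elliptope_perturbation[OF ext orth dec arg_cong[OF Tsym] this kl]
  show "Re (T k l) = Re 0" by simp
  have "(\<Sum>k<r. \<Sum>l<r. u k i * Im (T k l) * u l i) = 0" if "i < n" for i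
    using arg_cong[OF T0[OF that], of Im] by simp
  from extreme_elliptope_perturbation[OF ext orth dec arg_cong[OF Tsym] this kl]
  show "Im (T k l) = Im 0" by simp
qed

section \<open>Clifford relations forced by a factorization\<close>

lemma P_mat_carrier:
  assumes "C \<in> carrier_mat n n"
  shows "P_mat n C \<in> carrier_mat (2 * n) (2 * n)"
  using assms by (auto simp: P_mat_def ones_mat_def mult_2)

lemma P_mat_index:
  assumes "C \<in> carrier_mat n n" "i < n" "j < n"
  shows "P_mat n C $$ (i,j) = (1 + C $$ (i,j)) / 4"
    "P_mat n C $$ (i,n + j) = (1 - C $$ (i,j)) / 4"
    "P_mat n C $$ (n + i,j) = (1 - C $$ (i,j)) / 4"
    "P_mat n C $$ (n + i,n + j) = (1 + C $$ (i,j)) / 4"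
  using assms by (auto simp: P_mat_def ones_mat_def)

lemma cpsd_factorization_lower_bound:
  assumes n: "n \<ge> 1" and ext: "extreme_mat (elliptope n) C"
    and u: "\<And>k i. u k i = (\<Sum>j<n. C $$ (i,j) * f k j)"
    and orth: "\<And>k l. k < (r::nat) \<Longrightarrow> l < r \<Longrightarrow> (\<Sum>i<n. f k i * u l i) = (if k = l then 1 else 0)"
    and dec: "\<And>i j. i < n \<Longrightarrow> j < n \<Longrightarrow> C $$ (i,j) = (\<Sum>k<r. u k i * u k j)"
    and fact_d: "cpsd_factorization (2 * n) (P_mat n C) d"
  shows "2 ^ (r div 2) \<le> d * d"
proof -
  have C: "C \<in> carrier_mat n n" "\<And>i. i < n \<Longrightarrow> C $$ (i,i) = 1"
    using ext by (auto simp: extreme_mat_def elliptope_def real_psd_def)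
  obtain P where P: "\<And>i. i < 2 * n \<Longrightarrow> herm_psd d (P i)"
    and trP: "\<And>i j. i < 2 * n \<Longrightarrow> j < 2 * n \<Longrightarrow>
      mat_trace (P i * P j) = of_real (P_mat n C $$ (i,j))"
    using fact_d unfolding cpsd_factorization_def by metis
  define A where "A i = P i" for i
  define B where "B i = P (n + i)" for i
  have psd: "herm_psd d (A i)" "herm_psd d (B i)" if "i < n" for i
    using P that by (auto simp: A_def B_def)
  have herm: "herm_mat d (A i)" "herm_mat d (B i)" if "i < n" for i
    using psd[OF that] by (auto intro: herm_psd_imp_herm_mat)
  have car: "A i \<in> carrier_mat d d" "B i \<in> carrier_mat d d" if "i < n" for i
    using herm[OF that] by (auto dest: herm_matD)
  have tr: "mat_trace (A i * A j) = of_real ((1 + C $$ (i,j)) / 4)"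
    "mat_trace (A i * B j) = of_real ((1 - C $$ (i,j)) / 4)"
    "mat_trace (B i * A j) = of_real ((1 - C $$ (i,j)) / 4)"
    "mat_trace (B i * B j) = of_real ((1 + C $$ (i,j)) / 4)" if "i < n" "j < n" for i j
    using that by (simp_all only: A_def B_def trP P_mat_index[OF C(1)] mult_2 add_less_mono
        trans_less_add1 nat_add_left_cancel_less)
  define S where "S i = A i + B i" for i
  define M where "M i = A i - B i" for i
  have S: "herm_mat d (S i)" and M: "herm_mat d (M i)" if "i < n" for i
    using herm[OF that] by (auto simp: S_def M_def intro: herm_mat_add herm_mat_minus)
  have trS: "mat_trace (S i * S j) = 1" if "i < n" "j < n" for i j
  proof -
    have "mat_trace (S i * S j) = mat_trace (A i * A j) + mat_trace (A i * B j)
        + mat_trace (B i * A j) + mat_trace (B i * B j)"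
      using car[OF that(1)] car[OF that(2)]
      by (simp add: S_def mat_trace_mult[of _ d] sum.distrib algebra_simps)
    then show ?thesis
      by (simp only: tr[OF that] flip: of_real_add) (simp add: field_simps)
  qed
  have trM: "mat_trace (M i * M j) = of_real (C $$ (i,j))" if "i < n" "j < n" for i j
  proof -
    have "mat_trace (M i * M j) = mat_trace (A i * A j) - mat_trace (A i * B j)
        - mat_trace (B i * A j) + mat_trace (B i * B j)"
      using car[OF that(1)] car[OF that(2)]
      by (simp add: M_def mat_trace_mult[of _ d] minus_carrier_mat[of _ d d] sum.distrib sum_subtractf algebra_simps)
    then show ?thesis
      by (simp only: tr[OF that] flip: of_real_add of_real_diff) (simp add: field_simps)
  qed
  define K where "K = S 0"
  have K: "herm_mat d K" using S n by (simp add: K_def)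
  \<comment> \<open>All inner products of the S_i equal 1, so \<parallel>S_i - S_0\<parallel>^2 = 1
    - 1 - 1 + 1 = 0.\<close>
  have SK: "S i = K" if i: "i < n" for i
  proof -
    have "mat_trace ((S i - K) * (S i - K)) = mat_trace (S i * S i) - mat_trace (S i * K)
        - mat_trace (K * S i) + mat_trace (K * K)"
      using herm_matD(1)[OF S[OF i]] herm_matD(1)[OF K]
      by (simp add: mat_trace_mult[of _ d] minus_carrier_mat[of _ d d] sum.distrib sum_subtractf algebra_simps)
    also have "\<dots> = 0"
      using trS i n by (simp add: K_def)
    finally have "S i - K = 0\<^sub>m d d"
      by (intro herm_mat_trace_square_zero herm_mat_minus S[OF i] K)
    then have "S i $$ (a,b) = K $$ (a,b)" if "a < d" "b < d" for a b
      using that herm_matD(1)[OF S[OF i]] herm_matD(1)[OF K]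
      by (metis carrier_matD eq_iff_diff_eq_0 index_minus_mat(1) index_zero_mat(1))
    then show ?thesis
      using herm_matD(1)[OF S[OF i]] herm_matD(1)[OF K] by (intro eq_matI) auto
  qed
  have MM: "M i * M i = K * K" if i: "i < n" for i
  proof -
    note cari = car[OF i]
    \<comment> \<open>As C_ii = 1, Tr (A_i B_i) = 0. Without cross terms, the squares of A_i - B_i
      and A_i + B_i coincide.\<close>
    have z: "A i * B i = 0\<^sub>m d d" "B i * A i = 0\<^sub>m d d"
      using tr[OF i i] C(2)[OF i] psd[OF i] by (auto intro!: herm_psd_mult_zero)
    have c2: "A i * A i \<in> carrier_mat d d" "B i * B i \<in> carrier_mat d d"
      using cari by auto
    have "M i * M i = (A i * A i - B i * A i) - (A i * B i - B i * B i)"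
      using cari by (simp only: M_def minus_mult_distrib_mat[of _ d d _ _ d]
          mult_minus_distrib_mat[of _ d d _ d] minus_carrier_mat)
    also have "\<dots> = (A i * A i + B i * A i) + (A i * B i + B i * B i)"
    proof -
      have "(Y - 0\<^sub>m d d) - (0\<^sub>m d d - Z) = (Y + 0\<^sub>m d d) + (0\<^sub>m d d + Z)"
        if "Y \<in> carrier_mat d d" "Z \<in> carrier_mat d d" for Y Z :: "complex mat"
        using that by (intro eq_matI) auto
      from this[OF c2] show ?thesis unfolding z .
    qed
    also have "\<dots> = S i * S i"
      using cari by (simp only: S_def add_mult_distrib_mat[of _ d d _ _ d]
          mult_add_distrib_mat[of _ d d _ d] add_carrier_mat)
    finally show ?thesis by (simp only: SK[OF i])
  qed
  define X where "X k = mat d d (\<lambda>(a,b). \<Sum>i<n. of_real (f k i) * M i $$ (a,b))" for k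
  have X: "X k \<in> carrier_mat d d" for k by (simp add: X_def)
  have MX: "M i $$ (a,b) = (\<Sum>k<r. of_real (u k i) * X k $$ (a,b))"
    if i: "i < n" and ab: "a < d" "b < d" for i a b
  proof -
    \<comment> \<open>These are the coefficients of M_i - sum_k u_ik X_k in the M_j. They lie in the
      kernel of C because C f_k = u_k, and the squared norm of that combination is c^T C c.\<close>
    define c where "c j = (if j = i then 1 else 0) - (\<Sum>k<r. u k i * f k j)" for j
    define N where "N = mat d d (\<lambda>(a,b). \<Sum>j<n. of_real (c j) * M j $$ (a,b))"
    have N: "herm_mat d N"
      using herm_matD(2)[OF M] by (auto simp: herm_mat_def N_def)
    have Cc: "(\<Sum>l<n. C $$ (j,l) * c l) = 0" if j: "j < n" for j
    proof -
      have "(\<Sum>l<n. C $$ (j,l) * c l) = (\<Sum>l<n. C $$ (j,l) * (if l = i then 1 else 0))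
          - (\<Sum>l<n. \<Sum>k<r. u k i * (C $$ (j,l) * f k l))"
        by (simp add: c_def right_diff_distrib sum_subtractf sum_distrib_left mult.left_commute)
      also have "(\<Sum>l<n. C $$ (j,l) * (if l = i then 1 else 0)) = C $$ (j,i)"
        using i by (simp add: if_distrib cong: if_cong)
      also have "(\<Sum>l<n. \<Sum>k<r. u k i * (C $$ (j,l) * f k l)) = (\<Sum>k<r. u k i * u k j)"
        by (subst sum.swap) (simp add: u sum_distrib_left)
      finally show ?thesis
        using dec[OF j i] by (simp add: mult.commute)
    qed
    have "mat_trace (N * N) = (\<Sum>a<d. \<Sum>b<d. \<Sum>j<n. \<Sum>l<n.
        of_real (c j * c l) * (M j $$ (a,b) * M l $$ (b,a)))"
      by (simp add: mat_trace_mult[of _ d] N_def sum_product mult_ac)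
    also have "\<dots> = (\<Sum>j<n. \<Sum>l<n. \<Sum>a<d. \<Sum>b<d.
        of_real (c j * c l) * (M j $$ (a,b) * M l $$ (b,a)))"
      by (subst sum_rotate) (intro sum.cong refl sum_rotate)
    also have "\<dots> = (\<Sum>j<n. \<Sum>l<n. of_real (c j * c l) * mat_trace (M j * M l))"
      by (intro sum.cong refl)
        (simp add: mat_trace_mult[OF herm_matD(1)[OF M] herm_matD(1)[OF M]] sum_distrib_left)
    also have "\<dots> = of_real (\<Sum>j<n. c j * (\<Sum>l<n. C $$ (j,l) * c l))"
      by (simp add: trM sum_distrib_left mult_ac)
    also have "\<dots> = 0"
      by (simp add: Cc)
    finally have "N = 0\<^sub>m d d"
      using N by (intro herm_mat_trace_square_zero)
    then have "0 = N $$ (a,b)"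
      using ab by simp
    also have "\<dots> = (\<Sum>j<n. of_real (if j = i then 1 else 0) * M j $$ (a,b))
        - (\<Sum>j<n. \<Sum>k<r. of_real (u k i) * (of_real (f k j) * M j $$ (a,b)))"
      using ab by (simp add: N_def c_def left_diff_distrib sum_subtractf sum_distrib_right mult.assoc)
    also have "(\<Sum>j<n. of_real (if j = i then 1 else 0) * M j $$ (a,b)) = M i $$ (a,b)"
      using i by (simp add: if_distrib[of of_real] if_distrib[of "\<lambda>x. x * _"] cong: if_cong)
    also have "(\<Sum>j<n. \<Sum>k<r. of_real (u k i) * (of_real (f k j) * M j $$ (a,b))) =
        (\<Sum>k<r. of_real (u k i) * X k $$ (a,b))"
      using ab by (subst sum.swap) (simp add: X_def sum_distrib_left)
    finally show ?thesis by simp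
  qed
  have relation: "(X k * X l) $$ (a,b) + (X l * X k) $$ (a,b) = (if k = l then 2 else 0) * (K * K) $$ (a,b)"
    if kl: "k < r" "l < r" and ab: "a < d" "b < d" for k l a b
  proof -
    \<comment> \<open>For a fixed entry (a,b), M_i^2 = K^2 says that the form Y takes the value
      (K^2)_ab at every u_i. Since the u_i are unit vectors, delta_kl (K^2)_ab takes the same value.
      \<open>T\<close> is twice the difference, symmetrized to fit the perturbation lemma.\<close>
    define Y where "Y k l = (\<Sum>c<d. X k $$ (a,c) * X l $$ (c,b))" for k l
    define T where "T k l = Y k l + Y l k - (if k = l then 2 else 0) * (K * K) $$ (a,b)" for k l
    have XX: "(X k * X l) $$ (a,b) = Y k l" for k l
      using ab X[of k] X[of l] by (simp add: Y_def scalar_prod_def atLeast0LessThan)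
    have YM: "(\<Sum>k<r. \<Sum>l<r. of_real (u k i) * Y k l * of_real (u l i)) = (K * K) $$ (a,b)"
      if i: "i < n" for i
    proof -
      have "(K * K) $$ (a,b) = (\<Sum>c<d. M i $$ (a,c) * M i $$ (c,b))"
        unfolding MM[OF i, symmetric] using ab herm_matD(1)[OF M[OF i]]
        by (simp add: scalar_prod_def atLeast0LessThan)
      also have "\<dots> = (\<Sum>c<d. \<Sum>k<r. \<Sum>l<r.
          of_real (u k i) * X k $$ (a,c) * (of_real (u l i) * X l $$ (c,b)))"
        using ab by (intro sum.cong refl) (simp add: MX[OF i] sum_product)
      also have "\<dots> = (\<Sum>k<r. \<Sum>l<r. \<Sum>c<d.
          of_real (u k i) * X k $$ (a,c) * (of_real (u l i) * X l $$ (c,b)))"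
        by (rule sum_rotate[symmetric])
      also have "\<dots> = (\<Sum>k<r. \<Sum>l<r. of_real (u k i) * Y k l * of_real (u l i))"
        by (simp add: Y_def sum_distrib_left sum_distrib_right mult_ac)
      finally show ?thesis by simp
    qed
    have "T k l = 0"
    proof (rule extreme_elliptope_perturbation_complex[OF ext orth dec _ _ kl])
      show "T k l = T l k" for k l
        by (simp add: T_def)
    next
      fix i assume i: "i < n"
      have YM': "(\<Sum>k<r. \<Sum>l<r. of_real (u k i) * Y l k * of_real (u l i)) = (K * K) $$ (a,b)"
        using YM[OF i] by (subst sum.swap) (simp add: mult_ac)
      have "(\<Sum>k<r. \<Sum>l<r. of_real (u k i) * ((if k = l then 2 else 0) * (K * K) $$ (a,b)) * of_real (u l i))
          = (\<Sum>k<r. \<Sum>l<r. if k = l then 2 * (K * K) $$ (a,b) * of_real (u k i * u k i) else 0)"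
        by (intro sum.cong refl) auto
      also have "\<dots> = (\<Sum>k<r. 2 * (K * K) $$ (a,b) * of_real (u k i * u k i))"
        by (intro sum.cong refl) simp
      also have "\<dots> = 2 * (K * K) $$ (a,b) * of_real (\<Sum>k<r. u k i * u k i)"
        by (simp only: sum_distrib_left of_real_sum)
      also have "(\<Sum>k<r. u k i * u k i) = 1"
        using dec[OF i i] C(2)[OF i] by simp
      finally have KK: "(\<Sum>k<r. \<Sum>l<r. of_real (u k i) * ((if k = l then 2 else 0) * (K * K) $$ (a,b)) * of_real (u l i))
          = 2 * (K * K) $$ (a,b)" by simp
      have "(\<Sum>k<r. \<Sum>l<r. of_real (u k i) * T k l * of_real (u l i)) =
          (\<Sum>k<r. \<Sum>l<r. of_real (u k i) * Y k l * of_real (u l i))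
          + (\<Sum>k<r. \<Sum>l<r. of_real (u k i) * Y l k * of_real (u l i))
          - (\<Sum>k<r. \<Sum>l<r. of_real (u k i) * ((if k = l then 2 else 0) * (K * K) $$ (a,b)) * of_real (u l i))"
        unfolding T_def
        by (simp only: distrib_left distrib_right left_diff_distrib right_diff_distrib sum.distrib sum_subtractf)
      then show "(\<Sum>k<r. \<Sum>l<r. of_real (u k i) * T k l * of_real (u l i)) = 0"
        unfolding YM[OF i] YM' KK by simp
    qed
    then show ?thesis
      by (simp only: XX T_def) simp
  qed
  show ?thesis
  proof (rule clifford_dim_lower_bound[where X = X and L = "K * K"])
    show "X k * X l = - (X l * X k)" if kl: "k < r" "l < r" "k \<noteq> l" for k l
    proof (rule eq_matI)
      fix a b assume "a < dim_row (- (X l * X k))" "b < dim_col (- (X l * X k))"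
      then have ab: "a < d" "b < d" using X[of k] X[of l] by auto
      have "(X k * X l) $$ (a,b) + (X l * X k) $$ (a,b) = 0"
        using relation[OF kl(1,2) ab] kl(3) by (simp only: if_False mult_zero_left)
      moreover have "(- (X l * X k)) $$ (a,b) = - (X l * X k) $$ (a,b)"
        using ab X[of k] X[of l] by (intro index_uminus_mat(1)) auto
      ultimately show "(X k * X l) $$ (a,b) = (- (X l * X k)) $$ (a,b)"
        by (metis eq_neg_iff_add_eq_0)
    qed (use X[of k] X[of l] in auto)
    show "X k * X k = K * K" if k: "k < r" for k
    proof (rule eq_matI)
      fix a b assume "a < dim_row (K * K)" "b < dim_col (K * K)"
      then have ab: "a < d" "b < d" using herm_matD(1)[OF K] by auto
      have "2 * (X k * X k) $$ (a,b) = 2 * (K * K) $$ (a,b)"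
        using relation[OF k k ab] by (simp only: if_True refl mult_2)
      then show "(X k * X k) $$ (a,b) = (K * K) $$ (a,b)"
        by (simp only: mult_cancel_left) simp
    qed (use X[of k] herm_matD(1)[OF K] in auto)
    have "mat_trace (K * K) = 1"
      using trS[of 0 0] n by (simp add: K_def)
    then have "K \<noteq> 0\<^sub>m d d"
      by (auto simp: mat_trace_def)
    then show "mat_trace ((K * K) ^\<^sub>m p) \<noteq> 0" for p
      by (rule mat_trace_square_pow_nonzero[OF K])
    show "K * K \<in> carrier_mat d d"
      using mult_carrier_mat[OF herm_matD(1)[OF K] herm_matD(1)[OF K]] .
  qed (rule X)
qed

section \<open>Explicit factorizations and the final estimate\<close>

lemma P_mat_index_signed:
  assumes "C \<in> carrier_mat n n" "i < 2 * n" "j < 2 * n"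
  shows "P_mat n C $$ (i,j) = (1 + (if i < n then 1 else - 1) * (if j < n then 1 else - 1)
    * C $$ (if i < n then i else i - n, if j < n then j else j - n)) / 4"
  using assms by (auto simp: P_mat_def ones_mat_def)

lemma gram_lorentzI:
  fixes w :: "nat \<Rightarrow> nat \<Rightarrow> real"
  assumes X: "X \<in> carrier_mat N N"
    and unit: "\<And>i. i < N \<Longrightarrow> (\<Sum>k<r. (w i k)\<^sup>2) = 1"
    and index: "\<And>i j. i < N \<Longrightarrow> j < N \<Longrightarrow> X $$ (i,j) = (1 + (\<Sum>k<r. w i k * w j k)) / 4"
  shows "gram_lorentz N X"
proof -
  let ?l = "\<lambda>i. vec (Suc r) (case_nat (1/2) (\<lambda>k. w i k / 2))"
  have "?l i \<in> lorentz_cone (Suc r)" if "i < N" for i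
  proof -
    have "(\<Sum>k\<in>{1..<Suc r}. (?l i $ k)\<^sup>2) = (\<Sum>k<r. (w i k / 2)\<^sup>2)"
      unfolding One_nat_def sum.atLeast_Suc_lessThan_Suc_shift atLeast0LessThan
      by (intro sum.cong refl) simp
    also have "\<dots> = (1 / 2)\<^sup>2"
      using unit[OF that] by (simp add: power_divide flip: sum_divide_distrib)
    finally have norm: "sqrt (\<Sum>k\<in>{1..<Suc r}. (?l i $ k)\<^sup>2) = 1 / 2"
      by (simp only: real_sqrt_abs)
    show ?thesis
      unfolding lorentz_cone_def mem_Collect_eq norm by simp
  qed
  moreover have "X $$ (i,j) = ?l i \<bullet> ?l j" if "i < N" "j < N" for i j
  proof -
    have "?l i \<bullet> ?l j = (\<Sum>k\<in>{0..<Suc r}. ?l i $ k * ?l j $ k)"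
      by (simp add: scalar_prod_def)
    also have "\<dots> = 1 / 4 + (\<Sum>k<r. w i k / 2 * (w j k / 2))"
      unfolding sum.atLeast0_lessThan_Suc_shift by (simp add: atLeast0LessThan)
    also have "\<dots> = (1 + (\<Sum>k<r. w i k * w j k)) / 4"
      by (simp add: sum_divide_distrib add_divide_distrib)
    finally show ?thesis
      by (simp only: index[OF that])
  qed
  ultimately show ?thesis
    unfolding gram_lorentz_def using X
    by (intro conjI exI[of _ "Suc r"] exI[of _ ?l]) auto
qed

lemma cpsd_factorizationI:
  fixes w :: "nat \<Rightarrow> nat \<Rightarrow> real"
  assumes X: "X \<in> carrier_mat N N"
    and unit: "\<And>i. i < N \<Longrightarrow> (\<Sum>k<r. (w i k)\<^sup>2) = 1"
    and index: "\<And>i j. i < N \<Longrightarrow> j < N \<Longrightarrow> X $$ (i,j) = (1 + (\<Sum>k<r. w i k * w j k)) / 4"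
  shows "cpsd_factorization N X (2 ^ r)"
  unfolding cpsd_factorization_def
proof (intro conjI exI[of _ "\<lambda>i. clifford_proj r (w i)"] allI impI)
  show "herm_psd (2 ^ r) (clifford_proj r (w i))" if "i < N" for i
    using herm_psd_clifford_proj unit[OF that] .
  show "complex_of_real (X $$ (i,j)) = mat_trace (clifford_proj r (w i) * clifford_proj r (w j))"
    if "i < N" "j < N" for i j
    by (simp only: index[OF that] mat_trace_clifford_proj)
qed (use X in auto)

theorem theorem5p15:
  fixes n :: nat and C :: "real mat"
  assumes "n \<ge> 1"
    and "extreme_mat (elliptope n) C"
    and "vec_space.rank n C = r_max n"
  shows "gram_lorentz (2 * n) (P_mat n C) \<and> cpsd (2 * n) (P_mat n C) \<and>
         real (cpsd_rank (2 * n) (P_mat n C)) \<ge> sqrt 2 ^ (r_max n div 2)"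
proof -
  have C: "C \<in> carrier_mat n n" "\<And>i. i < n \<Longrightarrow> C $$ (i,i) = 1"
    and psd: "psd_form {..<n} (\<lambda>i j. C $$ (i,j))"
    using assms(2) by (auto simp: extreme_mat_def elliptope_def real_psd_iff_psd_form)
  obtain r f u where u: "\<And>k i. u k i = (\<Sum>j<n. C $$ (i,j) * f k j)"
    and orth: "\<And>k l. k < (r::nat) \<Longrightarrow> l < r \<Longrightarrow> (\<Sum>i<n. f k i * u l i) = (if k = l then 1 else 0)"
    and dec': "\<And>i j. i \<in> {..<n} \<Longrightarrow> j \<in> {..<n} \<Longrightarrow> C $$ (i,j) = (\<Sum>k<r. u k i * u k j)"
    by (rule psd_form_gram[OF psd]) (rule that)
  have dec: "C $$ (i,j) = (\<Sum>k<r. u k i * u k j)" if "i < n" "j < n" for i j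
    by (rule dec') (use that in auto)
  \<comment> \<open>The 2n unit vectors are u_i followed by -u_i: the sign of C in
    \<open>P_mat\<close> flips exactly when the two indices lie in different halves.\<close>
  define w where "w i k = (if i < n then u k i else - u k (i - n))" for i k
  have Pcar: "P_mat n C \<in> carrier_mat (2 * n) (2 * n)"
    using P_mat_carrier C(1) .
  have ww: "(\<Sum>k<r. w i k * w j k) = (if i < n then 1 else - 1) * (if j < n then 1 else - 1)
      * C $$ (if i < n then i else i - n, if j < n then j else j - n)"
    if "i < 2 * n" "j < 2 * n" for i j
    using that by (auto simp: w_def dec sum_negf)
  have index: "P_mat n C $$ (i,j) = (1 + (\<Sum>k<r. w i k * w j k)) / 4"
    if "i < 2 * n" "j < 2 * n" for i j
    unfolding ww[OF that] by (rule P_mat_index_signed[OF C(1) that])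
  have unit: "(\<Sum>k<r. (w i k)\<^sup>2) = 1" if "i < 2 * n" for i
    using ww[OF that that] C(2)[of i] C(2)[of "i - n"] that
    by (auto simp: power2_eq_square split: if_splits)
  have lorentz: "gram_lorentz (2 * n) (P_mat n C)"
    by (rule gram_lorentzI[where w = w and r = r, OF Pcar unit index])
  have fac: "cpsd_factorization (2 * n) (P_mat n C) (2 ^ r)"
    by (rule cpsd_factorizationI[where w = w, OF Pcar unit index])
  define d where "d = cpsd_rank (2 * n) (P_mat n C)"
  \<comment> \<open>The explicit factorization of size 2^r enters the lower bound too: it guarantees
    that the \<open>LEAST\<close> in \<open>cpsd_rank\<close> is attained by an actual
    factorization.\<close>
  have "cpsd_factorization (2 * n) (P_mat n C) d"
    unfolding d_def cpsd_rank_def by (rule LeastI[where P = "cpsd_factorization _ _", OF fac])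
  from cpsd_factorization_lower_bound[OF assms(1,2) u orth dec this]
  have "2 ^ (r div 2) \<le> d * d" .
  moreover have "r_max n \<le> r"
    using rank_le_of_gram[OF C(1) dec] assms(3) by simp
  then have "(2::nat) ^ (r_max n div 2) \<le> 2 ^ (r div 2)"
    by (intro power_increasing div_le_mono) auto
  ultimately have "2 ^ (r_max n div 2) \<le> d\<^sup>2"
    unfolding power2_eq_square by (rule order_trans[rotated])
  then have "real (2 ^ (r_max n div 2)) \<le> real (d\<^sup>2)"
    by (rule of_nat_mono)
  then have "(sqrt 2 ^ (r_max n div 2))\<^sup>2 \<le> (real d)\<^sup>2"
    by (simp flip: power_mult add: mult.commute) (simp add: power_mult)
  then have "sqrt 2 ^ (r_max n div 2) \<le> real d"
    by (rule power2_le_imp_le) simp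
  then show ?thesis
    using lorentz fac unfolding d_def cpsd_def by blast
qed

end
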